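(* Let $\mathbf f:\mathbf X\to\mathbf Y$ be a pro-morphism in the category HPol (i.e. a morphism of pro-HPol) and let $n\ge0$ be an integer. If $\dim\mathbf f\le n$, then for every Abelian group $G$ and every index $k>n$ the homology pro-morphism $H_k(\mathbf f;G):H_k(\mathbf X;G)\to H_k(\mathbf Y;G)$ is a zero-morphism of pro-groups.
   Context: HTop is the homotopy category of topological spaces: objects are all topological spaces, morphisms are homotopy classes of continuous maps, called H-maps. A polyhedron is the carrier $P=|K|$ (weak topology) of a simplicial complex $K$, and $\dim P\le n$ means every simplex of $K$ has dimension $\le n$. HPol is the full subcategory of HTop whose objects are the spaces having the homotopy type of a polyhedron. An inverse system $\mathbf X=(X_\lambda,p_{\lambda\lambda'},\Lambda)$ in a category consists of a directed set $\Lambda$, objects $X_\lambda$, and morphisms $p_{\lambda\lambda'}:X_{\lambda'}\to X_\lambda$ for $\lambda\le\lambda'$ with $p_{\lambda\lambda}=1$, $p_{\lambda\lambda'}p_{\lambda'\lambda''}=p_{\lambda\lambda''}$. A morphism of inverse systems $(f_\mu,\phi):\mathbf X\to\mathbf Y=(Y_\mu,q_{\mu\mu'},M)$ is a function $\phi:M\to\Lambda$ with morphisms $f_\mu:X_{\phi(\mu)}\to Y_\mu$ such that for all $\mu\le\mu'$ there is $\lambda\ge\phi(\mu),\phi(\mu')$ with $f_\mu p_{\phi(\mu)\lambda}=q_{\mu\mu'}f_{\mu'}p_{\phi(\mu')\lambda}$. Write $f_{\mu\lambda}:=f_\mu\circ p_{\phi(\mu)\lambda}$ for $\lambda\ge\phi(\mu)$.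 Two such morphisms are equivalent, $(f_\mu,\phi)\sim(f'_\mu,\phi')$, if for every $\mu$ there is $\lambda\ge\phi(\mu),\phi'(\mu)$ with $f_{\mu\lambda}=f'_{\mu\lambda}$. The pro-category has inverse systems as objects and equivalence classes $\mathbf f=[(f_\mu,\phi)]$ as morphisms (pro-morphisms). A morphism of inverse systems $(f_\mu,\phi)$ in HPol has $\dim(f_\mu,\phi)\le n$ if every $\mu\in M$ admits $\lambda\ge\phi(\mu)$ such that $f_{\mu\lambda}=v\circ u$ for some H-maps $u:X_\lambda\to P$, $v:P\to Y_\mu$ with $P$ a polyhedron, $\dim P\le n$. A pro-morphism $\mathbf f$ has $\dim\mathbf f\le n$ if it has a representative $(f_\mu,\phi)$ with $\dim(f_\mu,\phi)\le n$. Homology pro-groups: $H_k(\mathbf X;G)=(H_k(X_\lambda;G),H_k(p_{\lambda\lambda'};G),\Lambda)$ (singular homology), and if $\mathbf f$ is represented by $(f_\mu,\phi)$, then $H_k(\mathbf f;G)$ is the morphism of pro-groups represented by $(H_k(f_\mu;G),\phi)$. A zero-morphism of pro-groups is one that factors through the zero object (the trivial group) of the category of pro-groups. *)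

theory Defs
  imports "HOL-Homology.Homology"
begin

section \<open>Categories\<close>

text \<open>Arrows do not record their source and target, so identities and composition
  take the objects involved as arguments: \<open>Comp C A B D g f\<close> is the composite of
  \<open>f : A \<rightarrow> B\<close> and \<open>g : B \<rightarrow> D\<close>.\<close>

record ('o, 'm) cat =
  Obj :: "'o set"
  Hom :: "'o \<Rightarrow> 'o \<Rightarrow> 'm set"
  Ident :: "'o \<Rightarrow> 'm"
  Comp :: "'o \<Rightarrow> 'o \<Rightarrow> 'o \<Rightarrow> 'm \<Rightarrow> 'm \<Rightarrow> 'm"

definition is_category :: "('o, 'm) cat \<Rightarrow> bool" where
  "is_category C \<longleftrightarrow>
     (\<forall>A\<in>Obj C. Ident C A \<in> Hom C A A) \<and>
     (\<forall>A\<in>Obj C. \<forall>B\<in>Obj C. \<forall>D\<in>Obj C. \<forall>f\<in>Hom C A B. \<forall>g\<in>Hom C B D.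
        Comp C A B D g f \<in> Hom C A D) \<and>
     (\<forall>A\<in>Obj C. \<forall>B\<in>Obj C. \<forall>f\<in>Hom C A B.
        Comp C A A B f (Ident C A) = f \<and> Comp C A B B (Ident C B) f = f) \<and>
     (\<forall>A\<in>Obj C. \<forall>B\<in>Obj C. \<forall>D\<in>Obj C. \<forall>E\<in>Obj C.
        \<forall>f\<in>Hom C A B. \<forall>g\<in>Hom C B D. \<forall>h\<in>Hom C D E.
        Comp C A D E h (Comp C A B D g f) = Comp C A B E (Comp C B D E h g) f)"


section \<open>Inverse systems and pro-categories\<close>

record ('i, 'o, 'm) inv_sys =
  idx :: "'i set"
  leq :: "'i \<Rightarrow> 'i \<Rightarrow> bool"
  ob :: "'i \<Rightarrow> 'o"
  bond :: "'i \<Rightarrow> 'i \<Rightarrow> 'm"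

definition directed_set :: "'i set \<Rightarrow> ('i \<Rightarrow> 'i \<Rightarrow> bool) \<Rightarrow> bool" where
  "directed_set I r \<longleftrightarrow> I \<noteq> {} \<and>
     (\<forall>i\<in>I. r i i) \<and>
     (\<forall>i\<in>I. \<forall>j\<in>I. \<forall>k\<in>I. r i j \<longrightarrow> r j k \<longrightarrow> r i k) \<and>
     (\<forall>i\<in>I. \<forall>j\<in>I. \<exists>k\<in>I. r i k \<and> r j k)"

definition inverse_system :: "('o, 'm) cat \<Rightarrow> ('i, 'o, 'm) inv_sys \<Rightarrow> bool" where
  "inverse_system C X \<longleftrightarrow>
     directed_set (idx X) (leq X) \<and>
     (\<forall>i\<in>idx X. ob X i \<in> Obj C) \<and>
     (\<forall>i\<in>idx X. \<forall>j\<in>idx X. leq X i j \<longrightarrow> bond X i j \<in> Hom C (ob X j) (ob X i)) \<and>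
     (\<forall>i\<in>idx X. bond X i i = Ident C (ob X i)) \<and>
     (\<forall>i\<in>idx X. \<forall>j\<in>idx X. \<forall>k\<in>idx X. leq X i j \<longrightarrow> leq X j k \<longrightarrow>
        Comp C (ob X k) (ob X j) (ob X i) (bond X i j) (bond X j k) = bond X i k)"

text \<open>A morphism of systems is a pair \<open>(f, \<phi>)\<close>; \<open>shift\<close> at \<open>\<mu>\<close> and \<open>l\<close> is the composite of
  \<open>f \<mu>\<close> with the bonding morphism from \<open>l\<close> to \<open>\<phi> \<mu>\<close>. The values of \<open>f\<close> and \<open>\<phi>\<close> outside the
  index set of the target are irrelevant and are identified by \<open>sys_rel\<close>.\<close>

type_synonym ('i, 'j, 'm) sys_map = "('j \<Rightarrow> 'm) \<times> ('j \<Rightarrow> 'i)"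

definition shift ::
  "('o, 'm) cat \<Rightarrow> ('i, 'o, 'm) inv_sys \<Rightarrow> ('j, 'o, 'm) inv_sys \<Rightarrow>
   ('i, 'j, 'm) sys_map \<Rightarrow> 'j \<Rightarrow> 'i \<Rightarrow> 'm" where
  "shift C X Y r \<mu> l =
     Comp C (ob X l) (ob X (snd r \<mu>)) (ob Y \<mu>) (fst r \<mu>) (bond X (snd r \<mu>) l)"

definition sys_mors ::
  "('o, 'm) cat \<Rightarrow> ('i, 'o, 'm) inv_sys \<Rightarrow> ('j, 'o, 'm) inv_sys \<Rightarrow>
   ('i, 'j, 'm) sys_map set" where
  "sys_mors C X Y = {r.
     (\<forall>\<mu>\<in>idx Y. snd r \<mu> \<in> idx X \<and> fst r \<mu> \<in> Hom C (ob X (snd r \<mu>)) (ob Y \<mu>)) \<and>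
     (\<forall>\<mu>\<in>idx Y. \<forall>\<mu>'\<in>idx Y. leq Y \<mu> \<mu>' \<longrightarrow>
        (\<exists>l\<in>idx X. leq X (snd r \<mu>) l \<and> leq X (snd r \<mu>') l \<and>
           shift C X Y r \<mu> l =
           Comp C (ob X l) (ob Y \<mu>') (ob Y \<mu>) (bond Y \<mu> \<mu>') (shift C X Y r \<mu>' l)))}"

definition sys_rel ::
  "('o, 'm) cat \<Rightarrow> ('i, 'o, 'm) inv_sys \<Rightarrow> ('j, 'o, 'm) inv_sys \<Rightarrow>
   (('i, 'j, 'm) sys_map \<times> ('i, 'j, 'm) sys_map) set" where
  "sys_rel C X Y = {(r, r'). r \<in> sys_mors C X Y \<and> r' \<in> sys_mors C X Y \<and>
     (\<forall>\<mu>\<in>idx Y. \<exists>l\<in>idx X. leq X (snd r \<mu>) l \<and> leq X (snd r' \<mu>) l \<and>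
        shift C X Y r \<mu> l = shift C X Y r' \<mu> l)}"

definition pro_mors ::
  "('o, 'm) cat \<Rightarrow> ('i, 'o, 'm) inv_sys \<Rightarrow> ('j, 'o, 'm) inv_sys \<Rightarrow>
   ('i, 'j, 'm) sys_map set set" where
  "pro_mors C X Y = sys_mors C X Y // sys_rel C X Y"

definition sys_comp ::
  "('o, 'm) cat \<Rightarrow> ('i, 'o, 'm) inv_sys \<Rightarrow> ('j, 'o, 'm) inv_sys \<Rightarrow> ('k, 'o, 'm) inv_sys \<Rightarrow>
   ('j, 'k, 'm) sys_map \<Rightarrow> ('i, 'j, 'm) sys_map \<Rightarrow> ('i, 'k, 'm) sys_map" where
  "sys_comp C X Y Z s r =
     (\<lambda>\<nu>. Comp C (ob X (snd r (snd s \<nu>))) (ob Y (snd s \<nu>)) (ob Z \<nu>) (fst s \<nu>) (fst r (snd s \<nu>)),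
      snd r \<circ> snd s)"

definition pro_comp ::
  "('o, 'm) cat \<Rightarrow> ('i, 'o, 'm) inv_sys \<Rightarrow> ('j, 'o, 'm) inv_sys \<Rightarrow> ('k, 'o, 'm) inv_sys \<Rightarrow>
   ('j, 'k, 'm) sys_map set \<Rightarrow> ('i, 'j, 'm) sys_map set \<Rightarrow> ('i, 'k, 'm) sys_map set" where
  "pro_comp C X Y Z g f = (\<Union>s\<in>g. \<Union>r\<in>f. sys_rel C X Z `` {sys_comp C X Y Z s r})"


section \<open>Polyhedra\<close>

text \<open>A simplicial complex is given by its simplices, as finite nonempty sets of vertices;
  points of the carrier are given by their barycentric coordinates.\<close>

definition simplicial_complex_on :: "'v set set \<Rightarrow> bool" where
  "simplicial_complex_on K \<longleftrightarrow>
     (\<forall>s\<in>K. finite s \<and> s \<noteq> {} \<and> (\<forall>t. t \<subseteq> s \<longrightarrow> t \<noteq> {} \<longrightarrow> t \<in> K))"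

definition closed_simplex :: "'v set \<Rightarrow> ('v \<Rightarrow> real) set" where
  "closed_simplex s = {x. (\<forall>v. 0 \<le> x v) \<and> (\<forall>v. v \<notin> s \<longrightarrow> x v = 0) \<and> (\<Sum>v\<in>s. x v) = 1}"

definition complex_carrier :: "'v set set \<Rightarrow> ('v \<Rightarrow> real) set" where
  "complex_carrier K = (\<Union>s\<in>K. closed_simplex s)"

text \<open>Since \<open>s\<close> is finite, the product topology induces the Euclidean topology on
  \<open>closed_simplex s\<close>. The carrier of \<open>K\<close> itself has the weak topology.\<close>

definition polyhedron :: "'v set set \<Rightarrow> ('v \<Rightarrow> real) topology" where
  "polyhedron K = topology (\<lambda>U. U \<subseteq> complex_carrier K \<and>
     (\<forall>s\<in>K. openin (subtopology (powertop_real UNIV) (closed_simplex s)) (U \<inter> closed_simplex s)))"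

lemma istopology_weak:
  "istopology (\<lambda>U. U \<subseteq> complex_carrier K \<and>
     (\<forall>s\<in>K. openin (subtopology (powertop_real UNIV) (closed_simplex s)) (U \<inter> closed_simplex s)))"
proof -
  have int: "openin Z (S \<inter> T \<inter> C)" if "openin Z (S \<inter> C)" "openin Z (T \<inter> C)"
    for Z and S T C :: "('a \<Rightarrow> real) set"
    using openin_Int[OF that] by (simp only: Int_ac)
  have un: "openin Z (\<Union>\<U> \<inter> C)" if "\<And>S. S \<in> \<U> \<Longrightarrow> openin Z (S \<inter> C)"
    for Z \<U> and C :: "('a \<Rightarrow> real) set"
    unfolding Int_Union2 by (rule openin_Union) (use that in blast)
  show ?thesis
    unfolding istopology_def
  proof (intro conjI allI impI ballI, goal_cases)
    case (1 S T)
    then show ?case by (simp only: le_infI1)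
  next
    case (2 S T s)
    then show ?case by (intro int) simp_all
  next
    case (3 \<U>)
    then show ?case by (simp add: Sup_le_iff)
  next
    case (4 \<U> s)
    then show ?case by (intro un) simp_all
  qed
qed

lemma openin_polyhedron:
  "openin (polyhedron K) U \<longleftrightarrow> U \<subseteq> complex_carrier K \<and>
     (\<forall>s\<in>K. openin (subtopology (powertop_real UNIV) (closed_simplex s)) (U \<inter> closed_simplex s))"
  unfolding polyhedron_def by (rule fun_cong[OF topology_inverse'[OF istopology_weak[of K]]])

definition complex_dim_le :: "'v set set \<Rightarrow> nat \<Rightarrow> bool" where
  "complex_dim_le K n \<longleftrightarrow> (\<forall>s\<in>K. card s \<le> n + 1)"


section \<open>The homotopy categories of spaces and of polyhedra\<close>

definition htpy_rel :: "'a topology \<Rightarrow> 'b topology \<Rightarrow> (('a \<Rightarrow> 'b) \<times> ('a \<Rightarrow> 'b)) set" where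
  "htpy_rel A B = {(f, g). homotopic_with (\<lambda>_. True) A B f g}"

definition hmaps :: "'a topology \<Rightarrow> 'b topology \<Rightarrow> ('a \<Rightarrow> 'b) set set" where
  "hmaps A B = {f. continuous_map A B f} // htpy_rel A B"

definition hcomp ::
  "'a topology \<Rightarrow> 'b topology \<Rightarrow> 'c topology \<Rightarrow> ('b \<Rightarrow> 'c) set \<Rightarrow> ('a \<Rightarrow> 'b) set \<Rightarrow> ('a \<Rightarrow> 'c) set" where
  "hcomp A B C v u = (\<Union>g\<in>v. \<Union>f\<in>u. htpy_rel A C `` {g \<circ> f})"

lemma hmaps_htpy_class:
  "u \<in> hmaps A B \<longleftrightarrow> (\<exists>f. continuous_map A B f \<and> u = htpy_rel A B `` {f})"
  by (auto simp: hmaps_def quotient_def)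

lemma hcomp_htpy_class:
  assumes "continuous_map A B f" "continuous_map B C g"
  shows "hcomp A B C (htpy_rel B C `` {g}) (htpy_rel A B `` {f}) = htpy_rel A C `` {g \<circ> f}"
proof -
  have f: "homotopic_with (\<lambda>_. True) A B f f" and g: "homotopic_with (\<lambda>_. True) B C g g"
    using assms by auto
  have "homotopic_with (\<lambda>_. True) A C (g' \<circ> f') h \<longleftrightarrow> homotopic_with (\<lambda>_. True) A C (g \<circ> f) h"
    if "homotopic_with (\<lambda>_. True) A B f f'" "homotopic_with (\<lambda>_. True) B C g g'" for f' g' h
    by (rule iffI[OF homotopic_with_trans[OF homotopic_compose[OF that]]
          homotopic_with_trans[OF homotopic_with_symD[OF homotopic_compose[OF that]]]])
  then have "htpy_rel A C `` {g' \<circ> f'} = htpy_rel A C `` {g \<circ> f}"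
    if "f' \<in> htpy_rel A B `` {f}" "g' \<in> htpy_rel B C `` {g}" for f' g'
    using that by (simp add: htpy_rel_def Image_singleton)
  moreover have "f \<in> htpy_rel A B `` {f}" "g \<in> htpy_rel B C `` {g}"
    using f g by (simp_all add: htpy_rel_def)
  ultimately show ?thesis
    unfolding hcomp_def by blast
qed

definition HTop :: "('a topology, ('a \<Rightarrow> 'a) set) cat" where
  "HTop = \<lparr>Obj = UNIV, Hom = hmaps, Ident = (\<lambda>A. htpy_rel A A `` {id}), Comp = hcomp\<rparr>"

text \<open>The type argument provides the vertices of the simplicial complexes, since a definition
  cannot quantify over types. Likewise all spaces of \<open>HTop\<close> live on one type \<open>'a\<close>; any set of
  spaces can be realised on a common type by passing to disjoint copies.\<close>

definition HPol :: "'v itself \<Rightarrow> ('a topology, ('a \<Rightarrow> 'a) set) cat" where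
  "HPol _ = HTop\<lparr>Obj := {A. \<exists>K :: 'v set set. simplicial_complex_on K \<and>
                              A homotopy_equivalent_space polyhedron K}\<rparr>"

lemma is_category_HPol: "is_category (HPol V)"
  unfolding is_category_def HPol_def HTop_def cat.simps
proof (intro conjI ballI, goal_cases)
  case (1 A)
  then show ?case
    unfolding hmaps_htpy_class using continuous_map_id by blast
next
  case (2 A B D f g)
  then obtain f' g' where *: "continuous_map A B f'" "f = htpy_rel A B `` {f'}"
    "continuous_map B D g'" "g = htpy_rel B D `` {g'}"
    unfolding hmaps_htpy_class by blast
  then show ?case
    unfolding hmaps_htpy_class *(2,4) hcomp_htpy_class[OF *(1,3)]
    using continuous_map_compose[OF *(1,3)] by blast
next
  case (3 A B f)
  then obtain f' where *: "continuous_map A B f'" "f = htpy_rel A B `` {f'}"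
    unfolding hmaps_htpy_class by blast
  show ?case
    unfolding *(2) hcomp_htpy_class[OF continuous_map_id *(1)] by simp
next
  case (4 A B f)
  then obtain f' where *: "continuous_map A B f'" "f = htpy_rel A B `` {f'}"
    unfolding hmaps_htpy_class by blast
  show ?case
    unfolding *(2) hcomp_htpy_class[OF *(1) continuous_map_id] by simp
next
  case (5 A B D E f g h)
  then obtain f' g' h' where *: "continuous_map A B f'" "f = htpy_rel A B `` {f'}"
    "continuous_map B D g'" "g = htpy_rel B D `` {g'}"
    "continuous_map D E h'" "h = htpy_rel D E `` {h'}"
    unfolding hmaps_htpy_class by blast
  show ?case
    unfolding *(2,4,6) hcomp_htpy_class[OF *(1,3)] hcomp_htpy_class[OF *(3,5)]
      hcomp_htpy_class[OF continuous_map_compose[OF *(1,3)] *(5)]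
      hcomp_htpy_class[OF *(1) continuous_map_compose[OF *(3,5)]]
    by (simp only: comp_assoc)
qed

definition sys_dim_le ::
  "'v itself \<Rightarrow> ('i, 'a topology, ('a \<Rightarrow> 'a) set) inv_sys \<Rightarrow>
   ('j, 'a topology, ('a \<Rightarrow> 'a) set) inv_sys \<Rightarrow> ('i, 'j, ('a \<Rightarrow> 'a) set) sys_map \<Rightarrow> nat \<Rightarrow> bool" where
  "sys_dim_le V X Y r n \<longleftrightarrow>
     (\<forall>\<mu>\<in>idx Y. \<exists>l\<in>idx X. leq X (snd r \<mu>) l \<and>
        (\<exists>K :: 'v set set. simplicial_complex_on K \<and> complex_dim_le K n \<and>
          (\<exists>u\<in>hmaps (ob X l) (polyhedron K). \<exists>v\<in>hmaps (polyhedron K) (ob Y \<mu>).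
             shift (HPol V) X Y r \<mu> l = hcomp (ob X l) (polyhedron K) (ob Y \<mu>) v u)))"

definition pro_dim_le ::
  "'v itself \<Rightarrow> ('i, 'a topology, ('a \<Rightarrow> 'a) set) inv_sys \<Rightarrow>
   ('j, 'a topology, ('a \<Rightarrow> 'a) set) inv_sys \<Rightarrow> ('i, 'j, ('a \<Rightarrow> 'a) set) sys_map set \<Rightarrow> nat \<Rightarrow> bool" where
  "pro_dim_le V X Y f n \<longleftrightarrow> (\<exists>r\<in>f. sys_dim_le V X Y r n)"


section \<open>Groups and pro-groups\<close>

definition Grp :: "('h monoid, 'h \<Rightarrow> 'h) cat" where
  "Grp = \<lparr>Obj = {A. group A}, Hom = (\<lambda>A B. hom A B \<inter> extensional (carrier A)),
          Ident = (\<lambda>A. \<lambda>x\<in>carrier A. x), Comp = (\<lambda>A B C g f. compose (carrier A) g f)\<rparr>"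

lemma is_category_Grp: "is_category Grp"
  unfolding is_category_def Grp_def cat.simps
proof (intro conjI ballI, goal_cases)
  case (1 A)
  then show ?case
    by (auto simp: hom_def group.is_monoid monoid.m_closed)
next
  case (2 A B D f g)
  then show ?case
    by (auto simp: hom_def compose_def Pi_def group.is_monoid monoid.m_closed)
next
  case (3 A B f)
  then have "f \<in> carrier A \<rightarrow> carrier B" "f \<in> extensional (carrier A)"
    by (auto simp: hom_def)
  then show ?case
    by (rule compose_Id)
next
  case (4 A B f)
  then have "f \<in> carrier A \<rightarrow> carrier B" "f \<in> extensional (carrier A)"
    by (auto simp: hom_def)
  then show ?case
    by (rule Id_compose)
next
  case (5 A B D E f g h)
  then have "f \<in> carrier A \<rightarrow> carrier B"
    by (auto simp: hom_def)
  then show ?case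
    by (rule compose_assoc)
qed

text \<open>An object regarded as an inverse system over a one-point index set.\<close>

definition const_sys :: "('o, 'm) cat \<Rightarrow> 'o \<Rightarrow> (unit, 'o, 'm) inv_sys" where
  "const_sys C A = \<lparr>idx = {()}, leq = (\<lambda>_ _. True), ob = (\<lambda>_. A), bond = (\<lambda>_ _. Ident C A)\<rparr>"

definition zero_pro_morphism ::
  "('i, 'h monoid, 'h \<Rightarrow> 'h) inv_sys \<Rightarrow> ('j, 'h monoid, 'h \<Rightarrow> 'h) inv_sys \<Rightarrow>
   ('i, 'j, 'h \<Rightarrow> 'h) sys_map set \<Rightarrow> bool" where
  "zero_pro_morphism X Y h \<longleftrightarrow>
     (\<exists>T. trivial_group T \<and>
        (\<exists>u\<in>pro_mors Grp X (const_sys Grp T). \<exists>v\<in>pro_mors Grp (const_sys Grp T) Y.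
           h = pro_comp Grp X (const_sys Grp T) Y v u))"


section \<open>Singular homology with coefficients in an Abelian group\<close>

text \<open>The library treats integer coefficients only; here a chain with coefficients in
  the group \<open>'g\<close> is a finitely supported function from singular simplices to \<open>'g\<close>.\<close>

type_synonym ('a, 'g) gchain = "((nat \<Rightarrow> real) \<Rightarrow> 'a) \<Rightarrow>\<^sub>0 'g"

definition gboundary :: "nat \<Rightarrow> ('a, 'g::ab_group_add) gchain \<Rightarrow> ('a, 'g) gchain" where
  "gboundary p c = (if p = 0 then 0 else
     (\<Sum>\<sigma>\<in>Poly_Mapping.keys c. \<Sum>i\<le>p. Poly_Mapping.single (singular_face p i \<sigma>)
        (if even i then Poly_Mapping.lookup c \<sigma> else - Poly_Mapping.lookup c \<sigma>)))"

definition gchain_map :: "nat \<Rightarrow> ('a \<Rightarrow> 'b) \<Rightarrow> ('a, 'g::ab_group_add) gchain \<Rightarrow> ('b, 'g) gchain" where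
  "gchain_map p f c =
     (\<Sum>\<sigma>\<in>Poly_Mapping.keys c. Poly_Mapping.single (simplex_map p f \<sigma>) (Poly_Mapping.lookup c \<sigma>))"

definition gchains :: "nat \<Rightarrow> 'a topology \<Rightarrow> ('a, 'g::ab_group_add) gchain set" where
  "gchains p A = {c. Poly_Mapping.keys c \<subseteq> singular_simplex_set p A}"

definition gcycle_group :: "nat \<Rightarrow> 'a topology \<Rightarrow> ('a, 'g::ab_group_add) gchain monoid" where
  "gcycle_group p A =
     \<lparr>carrier = {c \<in> gchains p A. gboundary p c = 0}, monoid.mult = (+), one = 0\<rparr>"

definition gboundaries :: "nat \<Rightarrow> 'a topology \<Rightarrow> ('a, 'g::ab_group_add) gchain set" where
  "gboundaries p A = gboundary (Suc p) ` gchains (Suc p) A"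

definition ghomology :: "nat \<Rightarrow> 'a topology \<Rightarrow> ('a, 'g::ab_group_add) gchain set monoid" where
  "ghomology p A = gcycle_group p A Mod gboundaries p A"

text \<open>The image of a homology class \<open>z\<close> under the chain map lies in a single coset of the
  boundaries of \<open>B\<close>, so the set product below is that coset.\<close>

definition ghom_map ::
  "nat \<Rightarrow> 'a topology \<Rightarrow> 'b topology \<Rightarrow> ('a \<Rightarrow> 'b) \<Rightarrow>
   ('a, 'g::ab_group_add) gchain set \<Rightarrow> ('b, 'g) gchain set" where
  "ghom_map p A B f =
     (\<lambda>z\<in>carrier (ghomology p A). gboundaries p B <#>\<^bsub>gcycle_group p B\<^esub> gchain_map p f ` z)"

text \<open>By homotopy invariance, the choice of the representative does not matter.\<close>

definition ghom_hmap ::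
  "nat \<Rightarrow> 'a topology \<Rightarrow> 'b topology \<Rightarrow> ('a \<Rightarrow> 'b) set \<Rightarrow>
   ('a, 'g::ab_group_add) gchain set \<Rightarrow> ('b, 'g) gchain set" where
  "ghom_hmap p A B F = ghom_map p A B (SOME f. f \<in> F)"


section \<open>Homology pro-groups\<close>

definition homology_sys ::
  "'g itself \<Rightarrow> nat \<Rightarrow> ('i, 'a topology, ('a \<Rightarrow> 'a) set) inv_sys \<Rightarrow>
   ('i, ('a, 'g::ab_group_add) gchain set monoid,
        ('a, 'g) gchain set \<Rightarrow> ('a, 'g) gchain set) inv_sys" where
  "homology_sys G k X =
     \<lparr>idx = idx X, leq = leq X, ob = (\<lambda>l. ghomology k (ob X l)),
      bond = (\<lambda>l l'. ghom_hmap k (ob X l') (ob X l) (bond X l l'))\<rparr>"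

definition homology_sys_map ::
  "'g itself \<Rightarrow> nat \<Rightarrow> ('i, 'a topology, ('a \<Rightarrow> 'a) set) inv_sys \<Rightarrow>
   ('j, 'a topology, ('a \<Rightarrow> 'a) set) inv_sys \<Rightarrow> ('i, 'j, ('a \<Rightarrow> 'a) set) sys_map \<Rightarrow>
   ('i, 'j, ('a, 'g::ab_group_add) gchain set \<Rightarrow> ('a, 'g) gchain set) sys_map" where
  "homology_sys_map G k X Y r =
     (\<lambda>\<mu>. ghom_hmap k (ob X (snd r \<mu>)) (ob Y \<mu>) (fst r \<mu>), snd r)"

definition homology_pro ::
  "'g itself \<Rightarrow> nat \<Rightarrow> ('i, 'a topology, ('a \<Rightarrow> 'a) set) inv_sys \<Rightarrow>
   ('j, 'a topology, ('a \<Rightarrow> 'a) set) inv_sys \<Rightarrow> ('i, 'j, ('a \<Rightarrow> 'a) set) sys_map set \<Rightarrow>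
   ('i, 'j, ('a, 'g::ab_group_add) gchain set \<Rightarrow> ('a, 'g) gchain set) sys_map set" where
  "homology_pro G k X Y f =
     (\<Union>r\<in>f. sys_rel Grp (homology_sys G k X) (homology_sys G k Y) `` {homology_sys_map G k X Y r})"

end

theory Submission
  imports Defs
begin

text \<open>Singular homology with coefficients in \<open>G\<close> of a polyhedron of dimension at most \<open>n\<close> vanishes in
  degrees \<open>k > n\<close>. Hence some \<open>H\<^sub>k(f\<^sub>\<mu>\<^sub>\<lambda>; G)\<close> factors through a trivial group for every \<open>\<mu>\<close>, and
  a morphism of pro-groups with this property is equivalent to every morphism through the zero object.

  The library only knows integral chains, but its chain homotopies are natural additive operators, and
  those extend to chains with coefficients by tensoring with \<open>G\<close>. A cycle in a polyhedron has compact
  support and so lives in a finite subcomplex; there the claim follows by induction on the number of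
  vertices, from Mayer--Vietoris for the open star of a vertex and the complement of that vertex: these
  retract to a point and to a smaller complex, and their intersection retracts to the link of the vertex,
  whose dimension has dropped by one.\<close>

section \<open>Chains with coefficients\<close>

text \<open>The mere existence of a filling for each integral cycle does not by itself yield
  fillings with coefficients; an identity between additive operators does pass to coefficients. This
  is why homotopy invariance is derived from an explicit operator \<open>prism\<close>, for which
  cycles have to be filled on model spaces only.

  The retractions in the induction are formulas in barycentric coordinates. Their continuity is
  evident in the product topology but delicate in the weak topology of an infinite complex. All
  deformations therefore take place in the product topology, and the two topologies are exchanged
  only on a finite subcomplex, where they agree. The induction bounds the cardinality of simplices
  by the degree, so that passing to a link matches the degree shift of Mayer-Vietoris.

  On the side of pro-groups, only one representative is known to factor through polyhedra, at an
  index that depends on the target index, whereas \<open>homology_pro\<close> ranges over all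
  representatives. Vanishing is therefore formulated as eventual vanishing, which can be transported
  along equivalence.\<close>

text \<open>The action of the integers on an abelian group, as a difference of repeated sums of
  which at least one is empty.\<close>

definition int_scale :: "int \<Rightarrow> 'g::ab_group_add \<Rightarrow> 'g" where
  "int_scale n g = (\<Sum>i<nat n. g) - (\<Sum>i<nat (- n). g)"

text \<open>Common terms of the two sums cancel, so every presentation of an integer as a difference
  of naturals computes the same multiple. Additivity in the integer thereby becomes a regrouping of
  sums, with no further split by sign.\<close>

lemma int_scale_of_nat_diff: "int_scale (int a - int b) g = (\<Sum>i<a. g) - (\<Sum>i<b. g)"
proof -
  have add: "(\<Sum>i<m + k. g) = (\<Sum>i<m. g) + (\<Sum>i<k. g)" for m k :: nat
    by (induction k) (auto simp: algebra_simps)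
  show ?thesis
  proof (cases "b \<le> a")
    case True
    then have "(\<Sum>i<a. g) = (\<Sum>i<b. g) + (\<Sum>i<a - b. g)"
      using add[of b "a - b"] by simp
    moreover have "nat (int a - int b) = a - b" "nat (- (int a - int b)) = 0"
      using True by auto
    ultimately show ?thesis
      by (simp add: int_scale_def)
  next
    case False
    then have "(\<Sum>i<b. g) = (\<Sum>i<a. g) + (\<Sum>i<b - a. g)"
      using add[of a "b - a"] by simp
    moreover have "nat (int a - int b) = 0" "nat (- (int a - int b)) = b - a"
      using False by auto
    ultimately show ?thesis
      by (simp add: int_scale_def)
  qed
qed

lemma int_scale_0 [simp]: "int_scale 0 g = 0"
  and int_scale_1 [simp]: "int_scale 1 g = g"
  and int_scale_zero_right [simp]: "int_scale n 0 = 0"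
  by (simp_all add: int_scale_def)

lemma int_scale_diff: "int_scale (m - n) g = int_scale m g - int_scale n g"
proof -
  obtain a b c d where "m = int a - int b" "n = int c - int d"
    by (metis int_diff_cases)
  moreover have "(int a - int b) - (int c - int d) = int (a + d) - int (b + c)"
    by simp
  moreover have "(\<Sum>i<x + y. g) = (\<Sum>i<x. g) + (\<Sum>i<y. g)" for x y :: nat
    by (induction y) (auto simp: algebra_simps)
  ultimately show ?thesis
    by (simp only: int_scale_of_nat_diff) (simp add: algebra_simps)
qed

lemma int_scale_add_right: "int_scale n (g + h) = int_scale n g + int_scale n h"
  by (simp add: int_scale_def sum.distrib)

text \<open>The elementary tensor of \<open>c\<close> and \<open>g\<close>, once the free abelian
  group on the generators tensored with the coefficient group is identified with the finitely
  supported functions.\<close>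

definition tensor_chain :: "'g::ab_group_add \<Rightarrow> ('s \<Rightarrow>\<^sub>0 int) \<Rightarrow> ('s \<Rightarrow>\<^sub>0 'g)" where
  "tensor_chain g c = Poly_Mapping.map (\<lambda>n. int_scale n g) c"

lemma lookup_tensor_chain [simp]:
  "Poly_Mapping.lookup (tensor_chain g c) x = int_scale (Poly_Mapping.lookup c x) g"
  by (simp add: tensor_chain_def map.rep_eq when_def)

lemma tensor_chain_of [simp]: "tensor_chain g (frag_of s) = Poly_Mapping.single s g"
  by (rule poly_mapping_eqI) (simp add: lookup_single when_def)

lemma tensor_chain_0 [simp]: "tensor_chain g 0 = 0"
  by (rule poly_mapping_eqI) simp

lemma tensor_chain_diff: "tensor_chain g (a - b) = tensor_chain g a - tensor_chain g b"
  by (rule poly_mapping_eqI) (simp add: lookup_minus int_scale_diff)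

lemma tensor_chain_uminus: "tensor_chain g (- a) = - tensor_chain g a"
  using tensor_chain_diff[of g 0 a] by simp

lemma tensor_chain_add: "tensor_chain g (a + b) = tensor_chain g a + tensor_chain g b"
  using tensor_chain_diff[of g a "- b"] by (simp add: tensor_chain_uminus)

lemma tensor_chain_sum: "tensor_chain g (sum f I) = (\<Sum>i\<in>I. tensor_chain g (f i))"
  by (induction I rule: infinite_finite_induct) (auto simp: tensor_chain_add)

lemma tensor_chain_zero_left [simp]: "tensor_chain 0 c = 0"
  by (rule poly_mapping_eqI) simp

lemma tensor_chain_add_left: "tensor_chain (g + h) c = tensor_chain g c + tensor_chain h c"
  by (rule poly_mapping_eqI) (simp add: lookup_add int_scale_add_right)

lemma keys_tensor_chain: "Poly_Mapping.keys (tensor_chain g c) \<subseteq> Poly_Mapping.keys c"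
  by (auto simp: in_keys_iff)

text \<open>The counterpart of \<open>frag_induction\<close> for arbitrary coefficients: a chain is
  the finite sum of its terms at single generators, so additive properties need checking only
  there.\<close>

lemma poly_mapping_single_induct [consumes 1, case_names zero single add]:
  assumes c: "Poly_Mapping.keys c \<subseteq> S" and 0: "P 0"
    and single: "\<And>s g. s \<in> S \<Longrightarrow> P (Poly_Mapping.single s g)"
    and add: "\<And>a b. P a \<Longrightarrow> P b \<Longrightarrow> P (a + b)"
  shows "P (c :: 's \<Rightarrow>\<^sub>0 'g::ab_group_add)"
proof -
  have "P (\<Sum>s\<in>I. Poly_Mapping.single s (Poly_Mapping.lookup c s))"
    if "finite I" "I \<subseteq> Poly_Mapping.keys c" for I
    using that by (induction I) (use 0 single add c in auto)
  moreover have "c = (\<Sum>s\<in>Poly_Mapping.keys c. Poly_Mapping.single s (Poly_Mapping.lookup c s))"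
    by (rule poly_mapping_eqI) (simp add: lookup_sum lookup_single when_def in_keys_iff)
  ultimately show ?thesis
    by (metis finite_keys order_refl)
qed

text \<open>Only the values of \<open>h\<close> on generators matter; for additive \<open>h\<close> this is the tensor product
  of \<open>h\<close> with the identity of the coefficient group.\<close>

definition coeff_ext :: "(('s \<Rightarrow>\<^sub>0 int) \<Rightarrow> ('t \<Rightarrow>\<^sub>0 int)) \<Rightarrow> ('s \<Rightarrow>\<^sub>0 'g::ab_group_add) \<Rightarrow> ('t \<Rightarrow>\<^sub>0 'g)" where
  "coeff_ext h c = (\<Sum>s\<in>Poly_Mapping.keys c. tensor_chain (Poly_Mapping.lookup c s) (h (frag_of s)))"

lemma coeff_ext_0 [simp]: "coeff_ext h 0 = 0"
  by (simp add: coeff_ext_def)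

lemma coeff_ext_single [simp]: "coeff_ext h (Poly_Mapping.single s g) = tensor_chain g (h (frag_of s))"
  by (cases "g = 0") (auto simp: coeff_ext_def)

text \<open>Two chains and their sum, whose support may shrink by cancellation, can be summed over
  one common index set; this gives additivity of \<open>coeff_ext\<close>.\<close>

lemma coeff_ext_superset:
  assumes "finite I" "Poly_Mapping.keys c \<subseteq> I"
  shows "coeff_ext h c = (\<Sum>s\<in>I. tensor_chain (Poly_Mapping.lookup c s) (h (frag_of s)))"
  unfolding coeff_ext_def by (rule sum.mono_neutral_left) (use assms in \<open>auto simp: in_keys_iff\<close>)

lemma coeff_ext_add: "coeff_ext h (a + b) = coeff_ext h a + coeff_ext h b"
proof -
  let ?I = "Poly_Mapping.keys a \<union> Poly_Mapping.keys b"
  have "Poly_Mapping.keys (a + b) \<subseteq> ?I"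
    by (rule keys_add)
  then show ?thesis
    by (simp add: coeff_ext_superset[of ?I] lookup_add tensor_chain_add_left sum.distrib)
qed

lemma coeff_ext_uminus: "coeff_ext h (- a) = - coeff_ext h a"
  using coeff_ext_add[of h a "- a"] by (simp add: eq_neg_iff_add_eq_0 add.commute)

lemma coeff_ext_diff: "coeff_ext h (a - b) = coeff_ext h a - coeff_ext h b"
  using coeff_ext_add[of h a "- b"] by (simp add: coeff_ext_uminus)

lemma coeff_ext_cong:
  "(\<And>s. s \<in> Poly_Mapping.keys c \<Longrightarrow> h (frag_of s) = k (frag_of s)) \<Longrightarrow> coeff_ext h c = coeff_ext k c"
  by (simp add: coeff_ext_def)

text \<open>Additivity of \<open>h\<close> enters because \<open>coeff_ext\<close> reads
  \<open>h\<close> on generators only, whereas the right-hand side applies it to a whole integral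
  chain.\<close>

lemma coeff_ext_tensor_chain:
  assumes "\<And>a b. h (a - b) = h a - h b"
  shows "coeff_ext h (tensor_chain g c) = tensor_chain g (h c)"
proof -
  have 0: "h 0 = 0"
    using assms[of 0 0] by simp
  show ?thesis
    using subset_UNIV by (induction c rule: frag_induction) (auto simp: 0 assms tensor_chain_diff coeff_ext_diff)
qed

text \<open>Functoriality of the tensor product. The inner map is met only at generators; the outer
  one is applied to their images, which are arbitrary chains, and so must be additive.\<close>

lemma coeff_ext_compose:
  assumes "\<And>a b. k (a - b) = k a - k b"
  shows "coeff_ext k (coeff_ext h c) = coeff_ext (\<lambda>x. k (h x)) c"
  using subset_UNIV[of "Poly_Mapping.keys c"]
proof (induction c rule: poly_mapping_single_induct)
  case (single s g)
  then show ?case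
    by (simp add: coeff_ext_tensor_chain[OF assms])
qed (simp_all add: coeff_ext_add)

lemma coeff_ext_add_fun: "coeff_ext (\<lambda>x. h x + k x) c = coeff_ext h c + coeff_ext k c"
  by (simp add: coeff_ext_def tensor_chain_add sum.distrib)

lemma coeff_ext_diff_fun: "coeff_ext (\<lambda>x. h x - k x) c = coeff_ext h c - coeff_ext k c"
  by (simp add: coeff_ext_def tensor_chain_diff sum_subtractf)

lemma coeff_ext_zero_fun: "coeff_ext (\<lambda>x. 0) c = 0"
  by (simp add: coeff_ext_def)

lemma coeff_ext_ident: "coeff_ext (\<lambda>x. x) c = c"
  using subset_UNIV by (induction c rule: poly_mapping_single_induct) (auto simp: coeff_ext_add)

lemma keys_coeff_ext:
  "Poly_Mapping.keys (coeff_ext h c) \<subseteq> (\<Union>s\<in>Poly_Mapping.keys c. Poly_Mapping.keys (h (frag_of s)))"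
  unfolding coeff_ext_def using keys_sum keys_tensor_chain by fastforce

section \<open>Boundary and induced chain maps with coefficients\<close>

lemma gboundary_coeff_ext: "gboundary p c = coeff_ext (chain_boundary p) c"
proof -
  have 1: "tensor_chain g (frag_cmul ((-1) ^ i) (frag_of s)) = Poly_Mapping.single s (if even i then g else - g)"
    for g :: 'b and s :: "(nat \<Rightarrow> real) \<Rightarrow> 'a" and i
    by (cases "even i") (auto simp: tensor_chain_uminus single_uminus)
  show ?thesis
    by (auto simp: gboundary_def coeff_ext_def chain_boundary_of tensor_chain_sum 1 intro!: sum.cong)
qed

lemma gchain_map_coeff_ext: "gchain_map p f c = coeff_ext (chain_map p f) c"
  by (simp add: gchain_map_def coeff_ext_def)

lemma gboundary_add: "gboundary p (a + b) = gboundary p a + gboundary p b"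
  and gboundary_diff: "gboundary p (a - b) = gboundary p a - gboundary p b"
  and gboundary_uminus: "gboundary p (- a) = - gboundary p a"
  and gboundary_0 [simp]: "gboundary p 0 = 0"
  and gchain_map_add: "gchain_map p f (a + b) = gchain_map p f a + gchain_map p f b"
  and gchain_map_diff: "gchain_map p f (a - b) = gchain_map p f a - gchain_map p f b"
  and gchain_map_0 [simp]: "gchain_map p f 0 = 0"
  by (simp_all add: gboundary_coeff_ext gchain_map_coeff_ext
      coeff_ext_add coeff_ext_diff coeff_ext_uminus)

lemma gchains_0 [simp]: "0 \<in> gchains p A"
  and gchains_add: "a \<in> gchains p A \<Longrightarrow> b \<in> gchains p A \<Longrightarrow> a + b \<in> gchains p A"
  and gchains_uminus: "a \<in> gchains p A \<Longrightarrow> - a \<in> gchains p A"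
  and gchains_diff: "a \<in> gchains p A \<Longrightarrow> b \<in> gchains p A \<Longrightarrow> a - b \<in> gchains p A"
  using keys_add[of a b] keys_add[of a "- b"] by (auto simp: gchains_def keys_def)

lemma coeff_ext_gchains:
  assumes "c \<in> gchains p A" "\<And>s. singular_simplex p A s \<Longrightarrow> singular_chain q B (h (frag_of s))"
  shows "coeff_ext h c \<in> gchains q B"
  using assms keys_coeff_ext[of h c] by (fastforce simp: gchains_def singular_chain_def)

text \<open>Restricting to simplices of \<open>A\<close> is the point: integral identities, such as
  that the boundary squares to zero, are available for chains of a space and not for arbitrary
  formal sums.\<close>

lemma coeff_ext_eq:
  assumes "c \<in> gchains p A" "\<And>s. singular_chain p A (frag_of s) \<Longrightarrow> h (frag_of s) = k (frag_of s)"
  shows "coeff_ext h c = coeff_ext k c"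
  using assms by (intro coeff_ext_cong) (auto simp: gchains_def singular_chain_of)

lemma gboundary_in_gchains: "c \<in> gchains p A \<Longrightarrow> gboundary p c \<in> gchains (p - Suc 0) A"
  unfolding gboundary_coeff_ext
  by (erule coeff_ext_gchains) (simp add: singular_chain_boundary singular_chain_of)

lemma gchain_map_in_gchains:
  "c \<in> gchains p A \<Longrightarrow> continuous_map A B f \<Longrightarrow> gchain_map p f c \<in> gchains p B"
  unfolding gchain_map_coeff_ext
  by (erule coeff_ext_gchains) (simp add: singular_simplex_simplex_map singular_chain_of)

lemma gboundary_gboundary:
  assumes "c \<in> gchains p A"
  shows "gboundary (p - Suc 0) (gboundary p c) = 0"
proof -
  have "coeff_ext (\<lambda>x. chain_boundary (p - Suc 0) (chain_boundary p x)) c = coeff_ext (\<lambda>x. 0) c"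
    by (rule coeff_ext_eq[OF assms]) (rule chain_boundary_boundary)
  then show ?thesis
    unfolding gboundary_coeff_ext by (simp add: coeff_ext_compose chain_boundary_diff coeff_ext_zero_fun)
qed

lemma gboundary_gchain_map:
  assumes "c \<in> gchains p A"
  shows "gboundary p (gchain_map p f c) = gchain_map (p - Suc 0) f (gboundary p c)"
proof -
  have "coeff_ext (\<lambda>x. chain_boundary p (chain_map p f x)) c =
        coeff_ext (\<lambda>x. chain_map (p - Suc 0) f (chain_boundary p x)) c"
    by (rule coeff_ext_eq[OF assms]) (rule chain_boundary_chain_map)
  then show ?thesis
    unfolding gboundary_coeff_ext gchain_map_coeff_ext
    by (simp add: coeff_ext_compose chain_boundary_diff chain_map_diff)
qed

lemma gchain_map_compose: "gchain_map p (g \<circ> f) c = gchain_map p g (gchain_map p f c)"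
  unfolding gchain_map_coeff_ext
  by (simp add: coeff_ext_compose chain_map_diff chain_map_compose comp_def[of "chain_map p g"])

lemma gchain_map_id:
  assumes "c \<in> gchains p A"
  shows "gchain_map p id c = c"
proof -
  have "coeff_ext (chain_map p id) c = coeff_ext (\<lambda>x. x) c"
    by (rule coeff_ext_eq[OF assms]) (rule chain_map_ident)
  then show ?thesis
    by (simp add: gchain_map_coeff_ext coeff_ext_ident)
qed

lemma gchains_subtopology:
  "c \<in> gchains p (subtopology A S) \<longleftrightarrow>
     c \<in> gchains p A \<and> (\<forall>s\<in>Poly_Mapping.keys c. s ` standard_simplex p \<subseteq> S)"
  unfolding gchains_def by (fastforce simp: singular_simplex_subtopology)

lemma gchains_subtopology_mono:
  "c \<in> gchains p (subtopology A S) \<Longrightarrow> S \<subseteq> T \<Longrightarrow> c \<in> gchains p (subtopology A T)"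
  by (fastforce simp: gchains_subtopology)

lemma gchains_empty: "topspace A = {} \<Longrightarrow> c \<in> gchains p A \<Longrightarrow> c = 0"
  by (auto simp: gchains_def singular_simplex_empty subset_eq poly_mapping_eqI in_keys_iff)

section \<open>Homotopy invariance and the Mayer--Vietoris argument\<close>

text \<open>The identity is homotopic to a constant map, so the cycle is homologous to its image in
  a point, where cycles of positive degree bound. Integral existence is enough here, since it only
  serves to fill the model cycles of \<open>prism_chain\<close>.\<close>

lemma contractible_cycle_is_boundary:
  assumes "contractible_space A" "p > 0" "singular_chain p A c" "chain_boundary p c = 0"
  obtains d where "singular_chain (Suc p) A d" "chain_boundary (Suc p) d = c"
proof -
  have "singular_relboundary p A {} c"
  \<comment> \<open>The empty space counts as contractible, but it has no point to contract
    to.\<close>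
  proof (cases "topspace A = {}")
    case True
    then show ?thesis
      using assms by (simp add: singular_chain_empty)
  next
    case False
    then obtain a where a: "a \<in> topspace A" "homotopic_with (\<lambda>x. True) A A id (\<lambda>x. a)"
      using assms(1) by (metis contractible_space_alt ex_in_conv)
    have cyc: "singular_relcycle p A {} c"
      using assms by (simp add: singular_cycle)
    have "homotopic_with (\<lambda>h. h \<in> {} \<rightarrow> {}) A A id (\<lambda>x. a)"
      using a(2) by simp
    from homotopic_imp_homologous_rel_chain_maps[OF this cyc]
    have "singular_relboundary p A {} (c - chain_map p (\<lambda>x. a) c)"
      using assms(3) by (simp add: homologous_rel_def chain_map_ident)
    moreover have "singular_relboundary p A {} (chain_map p (\<lambda>x. a) c)"
    proof -
      let ?B = "subtopology A {a}"
      have tB: "topspace ?B = {a}"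
        using a by auto
      have "continuous_map A ?B (\<lambda>x. a)"
        using a by (simp add: continuous_map_in_subtopology)
      then have "singular_relcycle p ?B {} (chain_map p (\<lambda>x. a) c)"
        by (intro singular_relcycle_chain_map[OF cyc]) auto
      then have "singular_relboundary p ?B {} (chain_map p (\<lambda>x. a) c)"
        using singular_boundary_eq_cycle_singleton[OF tB] assms(2) by simp
      then show ?thesis
        unfolding singular_boundary using singular_chain_subtopology by blast
    qed
    ultimately show ?thesis
      using singular_relboundary_add by fastforce
  qed
  then show thesis
    using that by (auto simp: singular_boundary)
qed

section \<open>The natural prism operator\<close>

definition std_simplex :: "nat \<Rightarrow> (nat \<Rightarrow> real) topology" where
  "std_simplex p = subtopology (powertop_real UNIV) (standard_simplex p)"

definition cylinder :: "'a topology \<Rightarrow> (real \<times> 'a) topology" where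
  "cylinder A = prod_topology (top_of_set {0..1}) A"

lemma singular_simplex_std_simplex:
  "singular_simplex p A s \<longleftrightarrow> continuous_map (std_simplex p) A s \<and> s \<in> extensional (standard_simplex p)"
  by (simp add: singular_simplex_def std_simplex_def)

lemma contractible_std_simplex: "contractible_space (std_simplex p)"
proof -
  obtain a where a: "a \<in> standard_simplex p"
    using nonempty_standard_simplex by blast
  have *: "homotopic_with (\<lambda>x. True) (std_simplex p) (std_simplex p) id (\<lambda>x. a)"
    unfolding homotopic_with_def
  proof (intro exI conjI)
    have "continuous_map (prod_topology (top_of_set {0..1}) (std_simplex p)) (powertop_real UNIV)
       (\<lambda>z i. (1 - fst z) * snd z i + fst z * a i)"
      unfolding continuous_map_componentwise_UNIV
    proof
      fix i
      have "continuous_map (prod_topology (top_of_set {0..1}) (std_simplex p)) (powertop_real UNIV) snd"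
        unfolding std_simplex_def using continuous_map_snd continuous_map_in_subtopology by blast
      then have "continuous_map (prod_topology (top_of_set {0..1}) (std_simplex p)) euclideanreal (\<lambda>z. snd z i)"
        unfolding continuous_map_componentwise_UNIV by (rule spec)
      moreover have "continuous_map (prod_topology (top_of_set {0..1}) (std_simplex p)) euclideanreal fst"
        using continuous_map_fst continuous_map_in_subtopology by blast
      ultimately show "continuous_map (prod_topology (top_of_set {0..1}) (std_simplex p)) euclideanreal
          (\<lambda>z. (1 - fst z) * snd z i + fst z * a i)"
        by (intro continuous_intros) auto
    qed
    then show "continuous_map (prod_topology (top_of_set {0..1}) (std_simplex p)) (std_simplex p)
       (\<lambda>z i. (1 - fst z) * snd z i + fst z * a i)"
      unfolding std_simplex_def
      by (auto simp: continuous_map_in_subtopology intro!: convex_standard_simplex a)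
  qed auto
  then show ?thesis
    unfolding contractible_space_def by blast
qed

lemma contractible_cylinder:
  assumes "contractible_space A"
  shows "contractible_space (cylinder A)"
proof -
  have "contractible {0..1::real}"
    by (rule convex_imp_contractible) simp
  then have "contractible_space (top_of_set {0..1::real})"
    unfolding contractible_space_top_of_set .
  then show ?thesis
    unfolding cylinder_def contractible_space_prod_topology using assms by blast
qed

text \<open>A chain homotopy between the two ends of the cylinder that is natural in the space: it is
  determined by integral chains \<open>prism_chain p\<close> on the cylinder over the standard simplex, which
  exist since that cylinder is contractible (the method of acyclic models).\<close>

definition on_cylinder :: "(real \<times> 'a \<Rightarrow> 'b) \<Rightarrow> ((nat \<Rightarrow> real) \<Rightarrow> 'a) \<Rightarrow> real \<times> (nat \<Rightarrow> real) \<Rightarrow> 'b" where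
  "on_cylinder h s = (\<lambda>(t, x). h (t, s x))"

text \<open>The chain \<open>d\<close> stays a parameter because the recursion for
  \<open>prism_chain\<close> applies the operator of one degree before the next model chain has been
  chosen.\<close>

definition prism :: "nat \<Rightarrow> (real \<times> (nat \<Rightarrow> real)) chain \<Rightarrow> (real \<times> 'a \<Rightarrow> 'b) \<Rightarrow> 'a chain \<Rightarrow> 'b chain" where
  "prism p d h c = frag_extend (\<lambda>s. chain_map (Suc p) (on_cylinder h s) d) c"

abbreviation unit_simplex :: "nat \<Rightarrow> (nat \<Rightarrow> real) chain" where
  "unit_simplex p \<equiv> frag_of (restrict id (standard_simplex p))"

primrec prism_chain :: "nat \<Rightarrow> (real \<times> (nat \<Rightarrow> real)) chain" where
  "prism_chain 0 = (SOME d. singular_chain 1 (cylinder (std_simplex 0)) d \<and>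
     chain_boundary 1 d =
       chain_map 0 (Pair 1) (unit_simplex 0) - chain_map 0 (Pair 0) (unit_simplex 0))"
| "prism_chain (Suc p) = (SOME d. singular_chain (Suc (Suc p)) (cylinder (std_simplex (Suc p))) d \<and>
     chain_boundary (Suc (Suc p)) d =
       chain_map (Suc p) (Pair 1) (unit_simplex (Suc p)) - chain_map (Suc p) (Pair 0) (unit_simplex (Suc p))
       - prism p (prism_chain p) id (chain_boundary (Suc p) (unit_simplex (Suc p))))"

lemma prism_0 [simp]: "prism p d h 0 = 0"
  and prism_diff: "prism p d h (a - b) = prism p d h a - prism p d h b"
  and prism_of [simp]: "prism p d h (frag_of s) = chain_map (Suc p) (on_cylinder h s) d"
  by (simp_all add: prism_def frag_extend_diff)

lemma continuous_map_Pair_cylinder: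
  "t \<in> {0..1} \<Longrightarrow> continuous_map A (cylinder A) (Pair t)"
  by (simp add: cylinder_def continuous_map_pairwise o_def continuous_map_in_subtopology)

lemma singular_chain_unit_simplex: "singular_chain p (std_simplex p) (unit_simplex p)"
  unfolding singular_chain_of singular_simplex_def std_simplex_def[symmetric]
  by (auto intro: continuous_map_eq[OF continuous_map_id] simp: std_simplex_def)

lemma continuous_map_on_cylinder:
  assumes "continuous_map (cylinder A) B h" "singular_simplex p A s"
  shows "continuous_map (cylinder (std_simplex p)) B (on_cylinder h s)"
proof -
  have "continuous_map (cylinder (std_simplex p)) (cylinder A) (\<lambda>(t, x). (t, s x))"
    using assms(2) unfolding singular_simplex_std_simplex cylinder_def
    by (auto simp: case_prod_unfold continuous_map_pairwise o_def
        intro!: continuous_map_fst continuous_map_compose[OF continuous_map_snd, unfolded o_def])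
  from continuous_map_compose[OF this assms(1)] show ?thesis
    by (simp add: on_cylinder_def o_def case_prod_unfold)
qed

lemma singular_chain_prism:
  assumes d: "singular_chain (Suc p) (cylinder (std_simplex p)) d"
    and h: "continuous_map (cylinder A) B h" and c: "singular_chain p A c"
  shows "singular_chain (Suc p) B (prism p d h c)"
  unfolding prism_def
proof (rule singular_chain_extend)
  fix s
  assume "s \<in> Poly_Mapping.keys c"
  then have "singular_simplex p A s"
    using c by (auto simp: singular_chain_def)
  then show "singular_chain (Suc p) B (chain_map (Suc p) (on_cylinder h s) d)"
    by (intro singular_chain_chain_map[OF d] continuous_map_on_cylinder[OF h])
qed

text \<open>On the points of the model cylinder, following \<open>on_cylinder id t\<close> by
  \<open>on_cylinder h s\<close> is \<open>on_cylinder h\<close> of the composite simplex. Elsewhere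
  the two may differ, because \<open>simplex_map\<close> restricts its result, but a chain of the
  cylinder only sees its points.\<close>

lemma chain_map_prism_id:
  assumes d: "singular_chain (Suc p) (cylinder (std_simplex p)) d"
    and c: "singular_chain p (std_simplex q) c"
  shows "chain_map (Suc p) (on_cylinder h s) (prism p d id c) = prism p d h (chain_map p s c)"
  using c unfolding singular_chain_def
proof (induction rule: frag_induction)
  case (one t)
  have "(on_cylinder h s \<circ> on_cylinder id t) x = on_cylinder h (simplex_map p s t) x"
    if "x \<in> topspace (cylinder (std_simplex p))" for x
    using that by (auto simp: on_cylinder_def simplex_map_def cylinder_def std_simplex_def)
  then have "chain_map (Suc p) (on_cylinder h s \<circ> on_cylinder id t) d =
        chain_map (Suc p) (on_cylinder h (simplex_map p s t)) d"
    by (rule chain_map_eq[OF d])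
  then show ?case
    by (simp add: chain_map_compose del: id_apply)
qed (auto simp: prism_diff chain_map_diff)

text \<open>Every simplex \<open>s\<close> is the image under \<open>s\<close> of the model simplex,
  so its boundary is the image of the model boundary. In degree 0 the correction term is set to 0,
  as there is no lower prism.\<close>

lemma prism_natural:
  assumes d: "p \<noteq> 0 \<Longrightarrow> singular_chain p (cylinder (std_simplex (p - 1))) d"
    and s: "singular_simplex p A s"
  shows "chain_map p (on_cylinder h s) (if p = 0 then 0 else prism (p - 1) d id (chain_boundary p (unit_simplex p)))
    = (if p = 0 then 0 else prism (p - 1) d h (chain_boundary p (frag_of s)))"
proof (cases "p = 0")
  case False
  have u: "singular_chain (p - 1) (std_simplex p) (chain_boundary p (unit_simplex p))"
    using singular_chain_boundary[OF singular_chain_unit_simplex, of p] by simp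
  have "simplex_map p s (restrict id (standard_simplex p)) = s"
    using s by (auto simp: simplex_map_def singular_simplex_def extensional_def)
  then have "chain_map (p - 1) s (chain_boundary p (unit_simplex p)) = chain_boundary p (frag_of s)"
    using chain_boundary_chain_map[OF singular_chain_unit_simplex, of p s] by simp
  then show ?thesis
    using chain_map_prism_id[of "p - 1" d p "chain_boundary p (unit_simplex p)" h s] u d False by simp
qed auto

text \<open>The boundary formula is transported from the model simplex to each simplex
  \<open>s\<close> along \<open>on_cylinder h s\<close>. The correction terms \<open>r\<close> and
  \<open>r'\<close> are abstract so that degree 0 and positive degrees, and the construction as well
  as the final homotopy, are served by one argument.\<close>

lemma prism_chain_step:
  assumes d: "singular_chain (Suc p) (cylinder (std_simplex p)) d"
    and b: "chain_boundary (Suc p) d =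
       chain_map p (Pair 1) (unit_simplex p) - chain_map p (Pair 0) (unit_simplex p) - r"
    and r: "\<And>s. singular_simplex p A s \<Longrightarrow>
        chain_map p (on_cylinder h s) r = r' (chain_boundary p (frag_of s))"
    and r': "\<And>a b. r' (a - b) = r' a - r' b" "r' 0 = 0"
    and h: "continuous_map (cylinder A) B h" and c: "singular_chain p A c"
  shows "chain_boundary (Suc p) (prism p d h c) =
     chain_map p (\<lambda>x. h (1, x)) c - chain_map p (\<lambda>x. h (0, x)) c - r' (chain_boundary p c)"
  using c unfolding singular_chain_def
proof (induction rule: frag_induction)
  case (one s)
  then have s: "singular_simplex p A s"
    by simp
  have ends: "simplex_map p (on_cylinder h s) (simplex_map p (Pair t) (restrict id (standard_simplex p)))
      = simplex_map p (\<lambda>x. h (t, x)) s" for t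
    by (auto simp: simplex_map_def on_cylinder_def)
  have "chain_boundary (Suc p) (chain_map (Suc p) (on_cylinder h s) d) =
        chain_map p (on_cylinder h s) (chain_boundary (Suc p) d)"
    using chain_boundary_chain_map[OF d] by simp
  then show ?case
    using s by (simp add: b chain_map_diff r[OF s] ends)
qed (auto simp: prism_diff chain_boundary_diff chain_map_diff r')

text \<open>The prescribed boundary is a cycle: by the formula one degree lower, the boundary of the
  prism over the boundary cancels the boundaries of the two ends. Contractibility of the cylinder
  provides a filling in positive degrees, and \<open>SOME\<close> picks one.\<close>

lemma prism_chain:
  shows "singular_chain (Suc p) (cylinder (std_simplex p)) (prism_chain p)" (is ?chain)
    and "chain_boundary (Suc p) (prism_chain p) =
       chain_map p (Pair 1) (unit_simplex p) - chain_map p (Pair 0) (unit_simplex p)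
       - (if p = 0 then 0 else prism (p - 1) (prism_chain (p - 1)) id (chain_boundary p (unit_simplex p)))"
       (is ?bd)
proof -
  have "?chain \<and> ?bd"
  \<comment> \<open>Strong induction, since the formula in degree \<open>p - 1\<close> also refers
    to the model chain of degree \<open>p - 2\<close>.\<close>
  proof (induction p rule: less_induct)
    case (less p)
    let ?C = "cylinder (std_simplex p)"
    define e where "e = chain_map p (Pair 1) (unit_simplex p) - chain_map p (Pair 0) (unit_simplex p)
       - (if p = 0 then 0 else prism (p - 1) (prism_chain (p - 1)) id (chain_boundary p (unit_simplex p)))"
    have ends: "singular_chain p ?C (chain_map p (Pair t) (unit_simplex p))" if "t \<in> {0..1}" for t
      using singular_chain_chain_map[OF singular_chain_unit_simplex continuous_map_Pair_cylinder[OF that]] .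
    have "\<exists>d. singular_chain (Suc p) ?C d \<and> chain_boundary (Suc p) d = e"
    proof (cases p)
      case 0
      \<comment> \<open>Filling by contractibility requires positive degree, so degree 0 uses the
        vertical path over the only point \<open>?x\<close> of the 0-simplex. It is parametrised by
        \<open>1 - y 0\<close> because face 0, where \<open>y 0 = 0\<close>, carries the sign plus
        and has to be the upper end.\<close>
      let ?x = "\<lambda>j::nat. if j = 0 then 1 else 0::real"
      let ?path = "restrict (\<lambda>y. (1 - y 0, ?x)) (standard_simplex 1)"
      have "singular_simplex 1 ?C ?path"
      proof -
        have "continuous_map (std_simplex 1) ?C (\<lambda>y. (1 - y 0, ?x))"
          unfolding cylinder_def continuous_map_pairwise o_def
        proof (intro conjI)
          have "continuous_map (std_simplex 1) euclideanreal (\<lambda>y. 1 - y 0)"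
            unfolding std_simplex_def
            by (intro continuous_map_from_subtopology continuous_map_diff continuous_map_product_projection) auto
          then show "continuous_map (std_simplex 1) (top_of_set {0..1}) (\<lambda>y. fst (1 - y 0, ?x))"
            by (auto simp: continuous_map_in_subtopology std_simplex_def standard_simplex_def)
          show "continuous_map (std_simplex 1) (std_simplex p) (\<lambda>y. snd (1 - y 0, ?x))"
            by (simp add: std_simplex_def 0 standard_simplex_0)
        qed
        then show ?thesis
          unfolding singular_simplex_std_simplex
          by (auto intro: continuous_map_eq simp: std_simplex_def)
      qed
      moreover have "chain_boundary 1 (frag_of ?path) = e"
      proof -
        have "singular_face 1 0 ?path = simplex_map 0 (Pair 1) (restrict id (standard_simplex 0))"
          "singular_face 1 1 ?path = simplex_map 0 (Pair 0) (restrict id (standard_simplex 0))"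
          by (auto simp: singular_face_def simplex_map_def fun_eq_iff restrict_def standard_simplex_0
              simplical_face_def standard_simplex_def if_distrib cong: if_cong)
        then show ?thesis
          by (simp add: e_def 0 chain_boundary_of)
      qed
      ultimately show ?thesis
        using 0 by (auto intro!: exI[of _ "frag_of ?path"] simp: singular_chain_of)
    next
      case (Suc q)
      let ?d = "prism_chain q" and ?u = "chain_boundary p (unit_simplex p)"
      have d: "singular_chain (Suc q) (cylinder (std_simplex q)) ?d"
        and b: "chain_boundary (Suc q) ?d =
           chain_map q (Pair 1) (unit_simplex q) - chain_map q (Pair 0) (unit_simplex q)
          - (if q = 0 then 0 else prism (q - 1) (prism_chain (q - 1)) id (chain_boundary q (unit_simplex q)))"
        using less[of q] Suc by blast+
      have u: "singular_chain q (std_simplex p) ?u"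
        using singular_chain_boundary[OF singular_chain_unit_simplex, of p] Suc by simp
      have idc: "continuous_map (cylinder (std_simplex p)) ?C id"
        by (rule continuous_map_id)
      have "chain_boundary (Suc q) (prism q ?d id ?u) =
          chain_map q (\<lambda>x. id (1, x)) ?u - chain_map q (\<lambda>x. id (0, x)) ?u
          - (if q = 0 then 0 else prism (q - 1) (prism_chain (q - 1)) id (chain_boundary q ?u))"
      proof (rule prism_chain_step[OF d b _ _ _ idc u])
        fix s :: "(nat \<Rightarrow> real) \<Rightarrow> nat \<Rightarrow> real"
        assume "singular_simplex q (std_simplex p) s"
        then show "chain_map q (on_cylinder id s)
            (if q = 0 then 0 else prism (q - 1) (prism_chain (q - 1)) id (chain_boundary q (unit_simplex q))) =
            (if q = 0 then 0 else prism (q - 1) (prism_chain (q - 1)) id (chain_boundary q (frag_of s)))"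
          by (rule prism_natural[rotated]) (use less[of "q - 1"] Suc in auto)
      qed (simp_all add: prism_diff del: id_apply)
      \<comment> \<open>The lower correction is evaluated on the boundary of a boundary, so only the
        ends survive, and they cancel those in \<open>e\<close>.\<close>
      moreover have "chain_boundary q ?u = 0"
        using chain_boundary_boundary[OF singular_chain_unit_simplex, of p] Suc by simp
      ultimately have "chain_boundary p e = 0"
        using Suc by (simp add: e_def chain_boundary_diff
            chain_boundary_chain_map[OF singular_chain_unit_simplex] del: chain_map_of)
      moreover have "singular_chain p ?C e"
        unfolding e_def using Suc singular_chain_prism[OF d idc u]
        by (intro singular_chain_diff ends) simp_all
      ultimately show ?thesis
        using contractible_cycle_is_boundary[OF contractible_cylinder[OF contractible_std_simplex], of p]
          Suc by (metis zero_less_Suc)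
    qed
    moreover have "prism_chain p = (SOME d. singular_chain (Suc p) ?C d \<and> chain_boundary (Suc p) d = e)"
      by (cases p) (simp_all add: e_def del: chain_map_of)
    ultimately have "singular_chain (Suc p) ?C (prism_chain p) \<and> chain_boundary (Suc p) (prism_chain p) = e"
      by (metis (mono_tags, lifting) someI_ex)
    then show ?case
      unfolding e_def by blast
  qed
  then show ?chain ?bd
    by auto
qed

lemma prism_chain_homotopy:
  assumes h: "continuous_map (cylinder A) B h" and c: "singular_chain p A c"
  shows "chain_boundary (Suc p) (prism p (prism_chain p) h c) +
      prism (p - Suc 0) (prism_chain (p - Suc 0)) h (chain_boundary p c) =
      chain_map p (\<lambda>x. h (1, x)) c - chain_map p (\<lambda>x. h (0, x)) c"
proof -
  have "chain_boundary (Suc p) (prism p (prism_chain p) h c) =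
      chain_map p (\<lambda>x. h (1, x)) c - chain_map p (\<lambda>x. h (0, x)) c
      - (if p = 0 then 0 else prism (p - 1) (prism_chain (p - 1)) h (chain_boundary p c))"
  proof (rule prism_chain_step[OF prism_chain _ _ _ h c])
    fix s
    assume "singular_simplex p A s"
    then show "chain_map p (on_cylinder h s)
        (if p = 0 then 0 else prism (p - 1) (prism_chain (p - 1)) id (chain_boundary p (unit_simplex p))) =
        (if p = 0 then 0 else prism (p - 1) (prism_chain (p - 1)) h (chain_boundary p (frag_of s)))"
      by (rule prism_natural[rotated]) (use prism_chain(1)[of "p - 1"] in auto)
  qed (auto simp: prism_diff)
  \<comment> \<open>In degree 0 the truncated index \<open>p - Suc 0\<close> is harmless: the
    boundary there is 0.\<close>
  then show ?thesis
    by (cases p) (auto simp: chain_boundary_def)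
qed

lemma gboundariesI: "d \<in> gchains (Suc p) A \<Longrightarrow> gboundary (Suc p) d = c \<Longrightarrow> c \<in> gboundaries p A"
  by (auto simp: gboundaries_def)

lemma gboundariesE:
  assumes "c \<in> gboundaries p A"
  obtains d where "d \<in> gchains (Suc p) A" "c = gboundary (Suc p) d"
  using assms by (auto simp: gboundaries_def)

text \<open>The operator \<open>h\<close> is evaluated on simplices only, while \<open>h'\<close> is
  applied to boundaries and must be additive. After extension of coefficients the term with
  \<open>h'\<close> is applied to the boundary of the cycle \<open>c\<close> and disappears.\<close>

lemma chain_homotopy_gboundaries:
  assumes diff: "\<And>a b. h' (a - b) = h' a - h' b"
    and h: "\<And>s. singular_chain p A (frag_of s) \<Longrightarrow> singular_chain (Suc p) B (h (frag_of s))"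
    and eq: "\<And>s. singular_chain p A (frag_of s) \<Longrightarrow>
      chain_boundary (Suc p) (h (frag_of s)) + h' (chain_boundary p (frag_of s)) =
      f (frag_of s) - g (frag_of s)"
    and c: "c \<in> gchains p A" "gboundary p c = 0"
  shows "coeff_ext f c - coeff_ext g c \<in> gboundaries p B"
proof (rule gboundariesI)
  show "coeff_ext h c \<in> gchains (Suc p) B"
    using coeff_ext_gchains[OF c(1), of "Suc p" B h] h by (simp add: singular_chain_of)
  have "coeff_ext f c - coeff_ext g c =
      coeff_ext (\<lambda>x. chain_boundary (Suc p) (h x) + h' (chain_boundary p x)) c"
    unfolding coeff_ext_diff_fun[symmetric] by (rule coeff_ext_eq[OF c(1)]) (simp add: eq)
  also have "\<dots> = gboundary (Suc p) (coeff_ext h c) + coeff_ext h' (gboundary p c)"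
    by (simp add: gboundary_coeff_ext coeff_ext_add_fun coeff_ext_compose chain_boundary_diff diff)
  finally show "gboundary (Suc p) (coeff_ext h c) = coeff_ext f c - coeff_ext g c"
    by (simp add: c(2))
qed

lemma homotopic_gchain_map:
  assumes fg: "homotopic_with (\<lambda>_. True) A B f g" and c: "c \<in> gchains p A" "gboundary p c = 0"
  shows "gchain_map p f c - gchain_map p g c \<in> gboundaries p B"
proof -
  \<comment> \<open>The homotopy is reversed because \<open>homotopic_with\<close> starts at its
    left argument, whereas the prism formula is the end at 1 minus the end at 0.\<close>
  obtain h where h: "continuous_map (cylinder A) B h" "\<And>x. h (1, x) = f x" "\<And>x. h (0, x) = g x"
    using homotopic_with_symD[OF fg] unfolding homotopic_with_def cylinder_def by auto
  show ?thesis
    unfolding gchain_map_coeff_ext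
  proof (rule chain_homotopy_gboundaries[OF _ _ _ c])
    show "chain_boundary (Suc p) (prism p (prism_chain p) h (frag_of s)) +
        prism (p - Suc 0) (prism_chain (p - Suc 0)) h (chain_boundary p (frag_of s)) =
        chain_map p f (frag_of s) - chain_map p g (frag_of s)"
      if "singular_chain p A (frag_of s)" for s
      using prism_chain_homotopy[OF h(1) that] by (simp add: h(2,3))
    show "singular_chain (Suc p) B (prism p (prism_chain p) h (frag_of s))"
      if "singular_chain p A (frag_of s)" for s
      by (rule singular_chain_prism[OF prism_chain(1) h(1) that])
  qed (simp add: prism_diff)
qed

section \<open>Subdivision and chains subordinate to a cover\<close>

lemma iterated_subdivision_gchain:
  assumes c: "c \<in> gchains p A"
  shows "coeff_ext (singular_subdivision p ^^ n) c \<in> gchains p A"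
proof (rule coeff_ext_gchains[OF c])
  show "singular_chain p A ((singular_subdivision p ^^ n) (frag_of s))" if "singular_simplex p A s" for s
    by (induction n) (auto simp: singular_chain_of that singular_chain_singular_subdivision)
qed

text \<open>Iterated subdivision comes with an additive chain homotopy to the identity that works in
  every space, so it extends to coefficients like the prism.\<close>

lemma iterated_subdivision_homologous:
  assumes c: "c \<in> gchains p A" "gboundary p c = 0"
  shows "coeff_ext (singular_subdivision p ^^ n) c - c \<in> gboundaries p A"
proof -
  obtain h where h:
    "\<And>p c1 c2. h p (c1 - c2) = h p c1 - h p (c2 :: 'a chain)"
    "\<And>p X c. singular_chain p X c \<Longrightarrow> singular_chain (Suc p) X (h p c)"
    "\<And>p X c. singular_chain p X c \<Longrightarrow>
       chain_boundary (Suc p) (h p c) + h (p - Suc 0) (chain_boundary p c) = (singular_subdivision p ^^ n) c - c"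
    using chain_homotopic_iterated_singular_subdivision[of n] by metis
  have "coeff_ext (singular_subdivision p ^^ n) c - coeff_ext (\<lambda>x. x) c \<in> gboundaries p A"
    by (rule chain_homotopy_gboundaries[where h' = "h (p - Suc 0)" and h = "h p", OF h(1) h(2) h(3) c])
  then show ?thesis
    by (simp add: coeff_ext_ident)
qed

text \<open>Terms inside \<open>U\<close> go to the summand of \<open>U\<close>, including those
  also inside \<open>V\<close>; the remaining ones lie in \<open>V\<close>.\<close>

lemma gchain_split:
  assumes "c \<in> gchains p A" "\<And>s. s \<in> Poly_Mapping.keys c \<Longrightarrow>
    s ` standard_simplex p \<subseteq> U \<or> s ` standard_simplex p \<subseteq> V"
  obtains a b where "a \<in> gchains p (subtopology A U)" "b \<in> gchains p (subtopology A V)" "c = a + b"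
proof -
  define a where "a = (\<Sum>s\<in>{s\<in>Poly_Mapping.keys c. s ` standard_simplex p \<subseteq> U}.
     Poly_Mapping.single s (Poly_Mapping.lookup c s))"
  have a: "Poly_Mapping.lookup a s = (if s ` standard_simplex p \<subseteq> U then Poly_Mapping.lookup c s else 0)" for s
    unfolding a_def by (auto simp: lookup_sum lookup_single when_def in_keys_iff)
  have V: "x ` standard_simplex p \<subseteq> V"
    if "Poly_Mapping.lookup c x \<noteq> 0" "\<not> x ` standard_simplex p \<subseteq> U" for x
    using assms(2)[of x] that by (simp add: in_keys_iff)
  show thesis
  proof
    show "a \<in> gchains p (subtopology A U)" "c - a \<in> gchains p (subtopology A V)"
      using assms(1) V unfolding gchains_def
      by (auto simp: singular_simplex_subtopology in_keys_iff a lookup_minus subset_iff[of "Poly_Mapping.keys _"]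
          split: if_splits)
  qed simp
qed

text \<open>Each simplex has its own number of subdivisions after which all pieces are small, and
  they stay small under further subdivision. Since a chain has finitely many terms, the largest
  number works for all.\<close>

lemma gcycle_split:
  assumes "openin A U" "openin A V" "topspace A \<subseteq> U \<union> V"
    and c: "c \<in> gchains p A" "gboundary p c = 0"
  obtains a b where "a \<in> gchains p (subtopology A U)" "b \<in> gchains p (subtopology A V)"
    "a + b - c \<in> gboundaries p A"
proof -
  have "\<exists>n. \<forall>m\<ge>n. \<forall>t\<in>Poly_Mapping.keys ((singular_subdivision p ^^ m) (frag_of s)).
      t ` standard_simplex p \<subseteq> U \<or> t ` standard_simplex p \<subseteq> V"
    if "s \<in> Poly_Mapping.keys c" for s
  proof -
    have "singular_chain p A (frag_of s)"
      using c(1) that by (auto simp: gchains_def singular_chain_of)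
    then obtain n where n: "\<And>m t. n \<le> m \<Longrightarrow> t \<in> Poly_Mapping.keys ((singular_subdivision p ^^ m) (frag_of s))
        \<Longrightarrow> \<exists>W\<in>{U, V}. t \<in> standard_simplex p \<rightarrow> W"
      using sufficient_iterated_singular_subdivision_exists[of "{U, V}" A p "frag_of s"] assms(1-3)
      by (metis Union_insert Union_empty Un_empty_right insert_iff empty_iff)
    then show ?thesis
      by (intro exI[of _ n]) (auto simp: image_subset_iff_funcset)
  qed
  then obtain N where N: "\<And>s m t. s \<in> Poly_Mapping.keys c \<Longrightarrow> m \<ge> N s \<Longrightarrow>
      t \<in> Poly_Mapping.keys ((singular_subdivision p ^^ m) (frag_of s)) \<Longrightarrow>
      t ` standard_simplex p \<subseteq> U \<or> t ` standard_simplex p \<subseteq> V"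
    by metis
  \<comment> \<open>Inserting 0 keeps the maximum meaningful for the zero chain.\<close>
  define n where "n = Max (insert 0 (N ` Poly_Mapping.keys c))"
  have "N s \<le> n" if "s \<in> Poly_Mapping.keys c" for s
    unfolding n_def using that by simp
  then have "t ` standard_simplex p \<subseteq> U \<or> t ` standard_simplex p \<subseteq> V"
    if "t \<in> Poly_Mapping.keys (coeff_ext (singular_subdivision p ^^ n) c)" for t
    using that keys_coeff_ext[of "singular_subdivision p ^^ n" c] N by blast
  then obtain a b where "a \<in> gchains p (subtopology A U)" "b \<in> gchains p (subtopology A V)"
    "coeff_ext (singular_subdivision p ^^ n) c = a + b"
    using gchain_split[OF iterated_subdivision_gchain[OF c(1)]] by metis
  then show thesis
    using that iterated_subdivision_homologous[OF c, of n] by metis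
qed

section \<open>Spaces with vanishing homology in one degree\<close>

text \<open>Phrased with chains, which is what splitting arguments manipulate;
  \<open>carrier_ghomology_vanishing\<close> converts it into triviality of the quotient
  group.\<close>

definition homology_vanishes :: "'g::ab_group_add itself \<Rightarrow> nat \<Rightarrow> 'a topology \<Rightarrow> bool" where
  "homology_vanishes _ p A \<longleftrightarrow>
     (\<forall>c :: ('a, 'g) gchain. c \<in> gchains p A \<and> gboundary p c = 0 \<longrightarrow> c \<in> gboundaries p A)"

lemma homology_vanishesD:
  fixes c :: "('a, 'g::ab_group_add) gchain"
  shows "homology_vanishes TYPE('g) p A \<Longrightarrow> c \<in> gchains p A \<Longrightarrow> gboundary p c = 0 \<Longrightarrow> c \<in> gboundaries p A"
  by (simp add: homology_vanishes_def)

lemma gboundaries_add: "a \<in> gboundaries p A \<Longrightarrow> b \<in> gboundaries p A \<Longrightarrow> a + b \<in> gboundaries p A"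
  and gboundaries_diff: "a \<in> gboundaries p A \<Longrightarrow> b \<in> gboundaries p A \<Longrightarrow> a - b \<in> gboundaries p A"
  and gboundaries_uminus: "a \<in> gboundaries p A \<Longrightarrow> - a \<in> gboundaries p A"
  and gboundaries_0 [simp]: "0 \<in> gboundaries p A"
  unfolding gboundaries_def
  by (auto simp flip: gboundary_add gboundary_diff gboundary_uminus
      intro!: imageI gchains_add gchains_diff gchains_uminus intro: image_eqI[of _ _ 0])

lemma gboundaries_subtopology: "c \<in> gboundaries p (subtopology A S) \<Longrightarrow> c \<in> gboundaries p A"
  by (auto simp: gboundaries_def gchains_subtopology)

lemma gchain_map_gboundaries:
  "c \<in> gboundaries p A \<Longrightarrow> continuous_map A B f \<Longrightarrow> gchain_map p f c \<in> gboundaries p B"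
  by (metis diff_Suc_Suc gboundariesE gboundariesI gboundary_gchain_map gchain_map_in_gchains minus_nat.diff_0)

lemma gboundaries_cycle: "c \<in> gboundaries p A \<Longrightarrow> c \<in> gchains p A \<and> gboundary p c = 0"
  by (metis diff_Suc_Suc gboundariesE gboundary_gboundary gboundary_in_gchains minus_nat.diff_0)

text \<open>Exactness of the Mayer-Vietoris sequence at the homology of \<open>A\<close>, carried
  out on chains: a cycle is homologous to \<open>a + b\<close> with parts in \<open>U\<close> and
  \<open>V\<close>. The boundary of \<open>a\<close> is minus that of \<open>b\<close>, hence lies
  in the intersection and equals that of some \<open>d\<close> there; \<open>a - d\<close> and
  \<open>b + d\<close> are cycles that bound in the two parts.\<close>

lemma mayer_vietoris_vanishing:
  fixes A :: "'a topology"
  assumes UV: "openin A U" "openin A V" "topspace A \<subseteq> U \<union> V"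
    and U: "homology_vanishes TYPE('g::ab_group_add) (Suc p) (subtopology A U)"
    and V: "homology_vanishes TYPE('g) (Suc p) (subtopology A V)"
    and I: "homology_vanishes TYPE('g) p (subtopology A (U \<inter> V))"
  shows "homology_vanishes TYPE('g) (Suc p) A"
  unfolding homology_vanishes_def
proof safe
  fix c :: "('a, 'g) gchain"
  assume c: "c \<in> gchains (Suc p) A" "gboundary (Suc p) c = 0"
  obtain a b where a: "a \<in> gchains (Suc p) (subtopology A U)" and b: "b \<in> gchains (Suc p) (subtopology A V)"
    and abc: "a + b - c \<in> gboundaries (Suc p) A"
    using gcycle_split[OF UV c] .
  have ab: "gboundary (Suc p) b = - gboundary (Suc p) a"
    using gboundaries_cycle[OF abc] c(2) by (simp add: gboundary_add gboundary_diff eq_neg_iff_add_eq_0 add.commute)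
  have "gboundary (Suc p) a \<in> gchains p (subtopology A U)"
    "gboundary (Suc p) a \<in> gchains p (subtopology A V)"
    using gboundary_in_gchains[OF a] gchains_uminus[OF gboundary_in_gchains[OF b]] by (simp_all add: ab)
  then have "gboundary (Suc p) a \<in> gchains p (subtopology A (U \<inter> V))"
    by (auto simp: gchains_subtopology)
  moreover have "gboundary p (gboundary (Suc p) a) = 0"
    using gboundary_gboundary[OF a] by simp
  ultimately obtain d where d: "d \<in> gchains (Suc p) (subtopology A (U \<inter> V))"
    "gboundary (Suc p) a = gboundary (Suc p) d"
    using homology_vanishesD[OF I] gboundariesE by metis
  have "a - d \<in> gboundaries (Suc p) (subtopology A U)"
    by (rule homology_vanishesD[OF U])
      (use d in \<open>auto simp: gboundary_diff intro!: gchains_diff a elim: gchains_subtopology_mono\<close>)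
  moreover have "b + d \<in> gboundaries (Suc p) (subtopology A V)"
    by (rule homology_vanishesD[OF V])
      (use d ab in \<open>auto simp: gboundary_add intro!: gchains_add b elim: gchains_subtopology_mono\<close>)
  ultimately have "(a - d) + (b + d) - (a + b - c) \<in> gboundaries (Suc p) A"
    using gboundaries_diff[OF gboundaries_add abc] gboundaries_subtopology by blast
  then show "c \<in> gboundaries (Suc p) A"
    by simp
qed

text \<open>Up to a boundary, a cycle equals its image under \<open>g \<circ> f\<close>, which
  bounds since it passes through \<open>B\<close>. Each retraction below therefore calls for a
  single homotopy.\<close>

lemma homology_vanishes_dominated:
  fixes A :: "'a topology"
  assumes B: "homology_vanishes TYPE('g::ab_group_add) p B"
    and f: "continuous_map A B f" and g: "continuous_map B A g"
    and gf: "homotopic_with (\<lambda>_. True) A A (g \<circ> f) id"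
  shows "homology_vanishes TYPE('g) p A"
  unfolding homology_vanishes_def
proof safe
  fix c :: "('a, 'g) gchain"
  assume c: "c \<in> gchains p A" "gboundary p c = 0"
  have "gchain_map p f c \<in> gboundaries p B"
    using c by (intro homology_vanishesD[OF B] gchain_map_in_gchains[OF _ f]) (auto simp: gboundary_gchain_map)
  then have "gchain_map p (g \<circ> f) c \<in> gboundaries p A"
    unfolding gchain_map_compose by (rule gchain_map_gboundaries[OF _ g])
  then show "c \<in> gboundaries p A"
    using gboundaries_diff[OF _ homotopic_gchain_map[OF gf c]] by (fastforce simp: gchain_map_id[OF c(1)])
qed

lemma homology_vanishes_empty: "topspace A = {} \<Longrightarrow> homology_vanishes G p A"
  unfolding homology_vanishes_def using gchains_empty gboundaries_0 by blast

text \<open>A point has one simplex in each degree, and its boundary maps alternate between zero and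
  the identity. In odd degree the cycle is the boundary of the simplex above; in positive even
  degree the boundary is injective, so the coefficient vanishes.\<close>

lemma homology_vanishes_singleton:
  fixes A :: "'a topology"
  assumes A: "topspace A = {a}" and p: "p > 0"
  shows "homology_vanishes TYPE('g::ab_group_add) p A"
  unfolding homology_vanishes_def
proof safe
  fix c :: "('a, 'g) gchain"
  let ?s = "\<lambda>q. restrict (\<lambda>x. a) (standard_simplex q)"
  assume c: "c \<in> gchains p A" "gboundary p c = 0"
  then obtain g where g: "c = Poly_Mapping.single (?s p) g"
  proof -
    have "c = Poly_Mapping.single (?s p) (Poly_Mapping.lookup c (?s p))"
      using c(1) by (intro poly_mapping_eqI)
        (auto simp: gchains_def singular_simplex_singleton[OF A] lookup_single when_def in_keys_iff subset_eq)
    then show thesis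
      using that by blast
  qed
  have sing: "singular_chain q A (frag_of (?s q))" for q
    by (simp add: singular_chain_of singular_simplex_singleton[OF A])
  have bd: "gboundary q (Poly_Mapping.single (?s q) h) =
      (if q = 0 \<or> odd q then 0 else Poly_Mapping.single (?s (q - 1)) h)" for q and h :: 'g
    unfolding gboundary_coeff_ext by (simp add: chain_boundary_of_singleton[OF A sing])
  show "c \<in> gboundaries p A"
  proof (cases "odd p")
    case True
    then show ?thesis
      by (intro gboundariesI[of "Poly_Mapping.single (?s (Suc p)) g"])
        (auto simp: bd g gchains_def singular_simplex_singleton[OF A])
  next
    case False
    then have "g = 0"
      using c(2) p unfolding g bd by (simp add: poly_mapping_eq_iff fun_eq_iff) (metis lookup_single_eq)
    then show ?thesis
      by (simp add: g)
  qed
qed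

section \<open>Homology of finite-dimensional polyhedra\<close>

lemma closed_simplex_mono:
  assumes "finite s" "t \<subseteq> s"
  shows "closed_simplex t \<subseteq> closed_simplex s"
proof
  fix x
  assume "x \<in> closed_simplex t"
  moreover from this have "sum x s = sum x t"
    using assms by (intro sum.mono_neutral_right) (auto simp: closed_simplex_def)
  ultimately show "x \<in> closed_simplex s"
    using assms by (auto simp: closed_simplex_def)
qed

lemma closed_simplex_convex:
  assumes "x \<in> closed_simplex s" "y \<in> closed_simplex s" "0 \<le> t" "t \<le> 1"
  shows "(\<lambda>v. (1 - t) * x v + t * y v) \<in> closed_simplex s"
  using assms by (auto simp: closed_simplex_def sum.distrib simp flip: sum_distrib_left)

text \<open>The product topology on barycentric coordinates: coarser than the weak topology, and
  such that a map into it is continuous as soon as its coordinates are.\<close>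

abbreviation pointwise :: "('v \<Rightarrow> real) set \<Rightarrow> ('v \<Rightarrow> real) topology" where
  "pointwise S \<equiv> subtopology (powertop_real UNIV) S"

lemma continuous_map_coordinate: "continuous_map (pointwise S) euclideanreal (\<lambda>x. x v)"
  by (intro continuous_map_from_subtopology continuous_map_product_projection) auto

lemma homotopic_straight_line:
  assumes f: "continuous_map A (powertop_real UNIV) f" and g: "continuous_map A (powertop_real UNIV) g"
    and seg: "\<And>x t. x \<in> topspace A \<Longrightarrow> 0 \<le> t \<Longrightarrow> t \<le> 1 \<Longrightarrow> (\<lambda>v. (1 - t) * f x v + t * g x v) \<in> S"
  shows "homotopic_with (\<lambda>_. True) A (pointwise S) f g"
  unfolding homotopic_with_def
proof (intro exI conjI)
  let ?C = "prod_topology (top_of_set {0..1}) A"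
  have "continuous_map ?C (powertop_real UNIV) (\<lambda>z v. (1 - fst z) * f (snd z) v + fst z * g (snd z) v)"
    unfolding continuous_map_componentwise_UNIV
  proof
    fix v
    have "continuous_map A euclideanreal (\<lambda>x. f x v)" "continuous_map A euclideanreal (\<lambda>x. g x v)"
      using f g unfolding continuous_map_componentwise_UNIV by auto
    then have "continuous_map ?C euclideanreal (\<lambda>z. f (snd z) v)" "continuous_map ?C euclideanreal (\<lambda>z. g (snd z) v)"
      by (auto intro: continuous_map_compose[OF continuous_map_snd, unfolded o_def])
    moreover have "continuous_map ?C euclideanreal fst"
      using continuous_map_fst continuous_map_in_subtopology by blast
    ultimately show "continuous_map ?C euclideanreal (\<lambda>z. (1 - fst z) * f (snd z) v + fst z * g (snd z) v)"
      by (intro continuous_intros) auto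
  qed
  then show "continuous_map ?C (pointwise S) (\<lambda>z v. (1 - fst z) * f (snd z) v + fst z * g (snd z) v)"
    by (auto simp: continuous_map_in_subtopology intro!: seg)
qed auto

text \<open>Radial projection from the vertex \<open>v\<close> to the opposite face, rescaling the
  remaining coordinates to total mass 1. It is meaningful where \<open>x v < 1\<close>, that is,
  away from \<open>v\<close> itself.\<close>

definition opposite_face_proj :: "'v \<Rightarrow> ('v \<Rightarrow> real) \<Rightarrow> 'v \<Rightarrow> real" where
  "opposite_face_proj v x = (\<lambda>w. if w = v then 0 else x w / (1 - x v))"

lemma opposite_face_proj:
  assumes s: "finite s" "x \<in> closed_simplex s" and "x v < 1"
  shows "opposite_face_proj v x \<in> closed_simplex (s - {v})" "s - {v} \<noteq> {}"
proof -
  have eq: "sum x (s - {v}) = 1 - x v"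
    using s by (cases "v \<in> s") (auto simp: closed_simplex_def sum_diff1)
  have "(\<Sum>w\<in>s - {v}. opposite_face_proj v x w) = (\<Sum>w\<in>s - {v}. x w) / (1 - x v)"
    unfolding sum_divide_distrib by (rule sum.cong) (auto simp: opposite_face_proj_def)
  also have "\<dots> = 1"
    using assms by (simp add: eq)
  finally show "opposite_face_proj v x \<in> closed_simplex (s - {v})"
    using assms by (auto simp: closed_simplex_def opposite_face_proj_def)
  show "s - {v} \<noteq> {}"
    using eq assms(3) by (metis diff_gt_0_iff_gt less_irrefl sum.empty)
qed

lemma continuous_map_opposite_face_proj:
  assumes "\<And>x. x \<in> S \<Longrightarrow> x v < 1"
  shows "continuous_map (pointwise S) (powertop_real UNIV) (opposite_face_proj v)"
  unfolding continuous_map_componentwise_UNIV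
proof
  fix w
  have "continuous_map (pointwise S) euclideanreal (\<lambda>x. x w / (1 - x v))"
    by (intro continuous_map_real_divide continuous_intros continuous_map_coordinate) (use assms in force)
  then show "continuous_map (pointwise S) euclideanreal (\<lambda>x. opposite_face_proj v x w)"
    by (cases "w = v") (auto simp: opposite_face_proj_def)
qed

lemma continuous_map_pointwise_ident: "continuous_map (pointwise S) (powertop_real UNIV) id"
  by (rule continuous_map_from_subtopology[OF continuous_map_id])

definition vertex_deletion :: "'v set set \<Rightarrow> 'v \<Rightarrow> 'v set set" where
  "vertex_deletion K v = {s \<in> K. v \<notin> s}"

definition vertex_link :: "'v set set \<Rightarrow> 'v \<Rightarrow> 'v set set" where
  "vertex_link K v = {s. s \<noteq> {} \<and> v \<notin> s \<and> insert v s \<in> K}"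

lemma simplicial_complex_onD:
  assumes "simplicial_complex_on K" "s \<in> K"
  shows "finite s" "s \<noteq> {}" "t \<subseteq> s \<Longrightarrow> t \<noteq> {} \<Longrightarrow> t \<in> K"
  using assms unfolding simplicial_complex_on_def by blast+

lemma simplicial_complex_vertex_deletion:
  "simplicial_complex_on K \<Longrightarrow> simplicial_complex_on (vertex_deletion K v)"
  unfolding simplicial_complex_on_def vertex_deletion_def by blast

lemma simplicial_complex_vertex_link:
  assumes "simplicial_complex_on K"
  shows "simplicial_complex_on (vertex_link K v)"
  unfolding simplicial_complex_on_def
proof (intro ballI conjI allI impI)
  fix s t
  assume s: "s \<in> vertex_link K v"
  then show "finite s" "s \<noteq> {}"
    using simplicial_complex_onD(1)[OF assms, of "insert v s"] by (auto simp: vertex_link_def)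
  assume "t \<subseteq> s" "t \<noteq> {}"
  then show "t \<in> vertex_link K v"
    using s simplicial_complex_onD(3)[OF assms, of "insert v s" "insert v t"] by (auto simp: vertex_link_def)
qed

text \<open>Points of the carrier other than \<open>v\<close> are those with \<open>x v < 1\<close>.
  They slide along rays from \<open>v\<close> to the faces opposite \<open>v\<close>; the segment
  stays in the simplex containing the point, and its \<open>v\<close>-coordinate
  \<open>t * x v\<close> never reaches 1.\<close>

lemma homology_vanishes_off_vertex:
  assumes K: "simplicial_complex_on K"
    and v: "homology_vanishes TYPE('g::ab_group_add) p (pointwise (complex_carrier (vertex_deletion K v)))"
  shows "homology_vanishes TYPE('g) p (pointwise {x \<in> complex_carrier K. x v < 1})"
    (is "homology_vanishes _ p (pointwise ?U)")
proof (rule homology_vanishes_dominated[OF v])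
  have proj: "opposite_face_proj v x \<in> closed_simplex (s - {v})" "s - {v} \<in> vertex_deletion K v"
    "opposite_face_proj v x \<in> closed_simplex s"
    if "s \<in> K" "x \<in> closed_simplex s" "x v < 1" for x s
    using that opposite_face_proj[of s x v] simplicial_complex_onD[OF K that(1)]
      closed_simplex_mono[of s "s - {v}"] by (auto simp: vertex_deletion_def)
  have cont: "continuous_map (pointwise ?U) (powertop_real UNIV) (opposite_face_proj v)"
    by (rule continuous_map_opposite_face_proj) auto
  show "continuous_map (pointwise ?U) (pointwise (complex_carrier (vertex_deletion K v))) (opposite_face_proj v)"
    using cont proj by (fastforce simp: continuous_map_in_subtopology complex_carrier_def)
  have "x \<in> ?U" if "x \<in> complex_carrier (vertex_deletion K v)" for x
    using that by (auto simp: complex_carrier_def vertex_deletion_def closed_simplex_def)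
  then show "continuous_map (pointwise (complex_carrier (vertex_deletion K v))) (pointwise ?U) id"
    by (auto simp: continuous_map_in_subtopology continuous_map_pointwise_ident)
  have "homotopic_with (\<lambda>_. True) (pointwise ?U) (pointwise ?U) (opposite_face_proj v) id"
  proof (rule homotopic_straight_line[OF cont continuous_map_pointwise_ident])
    fix x and t :: real
    assume "x \<in> topspace (pointwise ?U)" and t: "0 \<le> t" "t \<le> 1"
    then obtain s where s: "s \<in> K" "x \<in> closed_simplex s" "x v < 1"
      by (auto simp: complex_carrier_def)
    have "t * x v < 1"
      using s(2,3) t mult_left_le_one_le[of "x v" t] by (auto simp: closed_simplex_def)
    then show "(\<lambda>w. (1 - t) * opposite_face_proj v x w + t * id x w) \<in> ?U"
      using closed_simplex_convex[OF proj(3)[OF s] s(2) t] s(1)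
      by (auto simp: complex_carrier_def opposite_face_proj_def)
  qed
  then show "homotopic_with (\<lambda>_. True) (pointwise ?U) (pointwise ?U) (id \<circ> opposite_face_proj v) id"
    by simp
qed

text \<open>A simplex containing a point with positive \<open>v\<close>-coordinate has
  \<open>v\<close> as a vertex, so the segment to \<open>v\<close> stays inside it: the open star
  contracts to \<open>v\<close>.\<close>

lemma homology_vanishes_open_star:
  assumes K: "simplicial_complex_on K" and v: "{v} \<in> K" and p: "p > 0"
  shows "homology_vanishes TYPE('g::ab_group_add) p (pointwise {x \<in> complex_carrier K. 0 < x v})"
    (is "homology_vanishes _ p (pointwise ?V)")
proof -
  define e where "e = (\<lambda>w. if w = v then 1 else 0 :: real)"
  have e: "e \<in> closed_simplex s" if "v \<in> s" "finite s" for s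
    using that by (auto simp: closed_simplex_def e_def)
  have eV: "e \<in> ?V"
    using e[of "{v}"] v by (auto simp: complex_carrier_def e_def)
  have "homology_vanishes TYPE('g) p (pointwise {e})"
    by (rule homology_vanishes_singleton[OF _ p]) simp
  then show ?thesis
  proof (rule homology_vanishes_dominated)
    show "continuous_map (pointwise ?V) (pointwise {e}) (\<lambda>_. e)"
      by (simp add: continuous_map_in_subtopology)
    show "continuous_map (pointwise {e}) (pointwise ?V) id"
      using eV by (simp add: continuous_map_in_subtopology continuous_map_pointwise_ident)
    have "homotopic_with (\<lambda>_. True) (pointwise ?V) (pointwise ?V) (\<lambda>_. e) id"
    proof (rule homotopic_straight_line[OF _ continuous_map_pointwise_ident])
      fix x and t :: real
      assume "x \<in> topspace (pointwise ?V)" and t: "0 \<le> t" "t \<le> 1"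
      then obtain s where s: "s \<in> K" "x \<in> closed_simplex s" "0 < x v"
        by (auto simp: complex_carrier_def)
      then have "v \<in> s"
        by (auto simp: closed_simplex_def)
      then have "e \<in> closed_simplex s"
        using e simplicial_complex_onD[OF K s(1)] by simp
      moreover have "0 < (1 - t) * e v + t * x v"
        using t s(3) by (cases "t = 1") (auto simp: e_def intro: add_pos_nonneg)
      ultimately show "(\<lambda>w. (1 - t) * e w + t * id x w) \<in> ?V"
        using closed_simplex_convex[OF _ s(2) t] s(1) by (auto simp: complex_carrier_def)
    qed simp
    then show "homotopic_with (\<lambda>_. True) (pointwise ?V) (pointwise ?V) (id \<circ> (\<lambda>_. e)) id"
      by simp
  qed
qed

text \<open>The open star without \<open>v\<close> is, up to homotopy, the link: radial projection
  forgets the distance from \<open>v\<close>, and \<open>mid\<close> re-enters at a fixed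
  distance.\<close>

lemma homology_vanishes_punctured_star:
  assumes K: "simplicial_complex_on K"
    and v: "homology_vanishes TYPE('g::ab_group_add) p (pointwise (complex_carrier (vertex_link K v)))"
  shows "homology_vanishes TYPE('g) p (pointwise {x \<in> complex_carrier K. 0 < x v \<and> x v < 1})"
    (is "homology_vanishes _ p (pointwise ?W)")
proof (rule homology_vanishes_dominated[OF v])
  \<comment> \<open>The midpoint between \<open>v\<close> and a point of the link. The value 1/2 is
    just a choice strictly between 0 and 1; the other coordinates are halved so that the sum is
    1.\<close>
  define mid where "mid y = (\<lambda>w. if w = v then 1 / 2 else y w / 2)" for y :: "'a \<Rightarrow> real"
  have proj: "opposite_face_proj v x \<in> closed_simplex (s - {v})" "s - {v} \<in> vertex_link K v" "v \<in> s"
    if "s \<in> K" "x \<in> closed_simplex s" "0 < x v" "x v < 1" for x s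
  proof -
    show "v \<in> s"
      using that by (auto simp: closed_simplex_def)
    then show "opposite_face_proj v x \<in> closed_simplex (s - {v})" "s - {v} \<in> vertex_link K v"
      using that opposite_face_proj[of s x v] simplicial_complex_onD[OF K that(1)]
      by (auto simp: vertex_link_def insert_absorb)
  qed
  have mid: "mid y \<in> closed_simplex (insert v s)" if "y \<in> closed_simplex s" "finite s" "v \<notin> s" for y s
  proof -
    have "(\<Sum>w\<in>s. mid y w) = (\<Sum>w\<in>s. y w / 2)"
      by (rule sum.cong) (use that in \<open>auto simp: mid_def\<close>)
    also have "\<dots> = 1 / 2"
      unfolding sum_divide_distrib[symmetric] using that by (simp add: closed_simplex_def)
    finally have "(\<Sum>w\<in>insert v s. mid y w) = 1"
      using that by (simp add: mid_def)
    then show ?thesis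
      using that(1) by (auto simp: closed_simplex_def mid_def)
  qed
  have contp: "continuous_map (pointwise ?W) (powertop_real UNIV) (opposite_face_proj v)"
    by (rule continuous_map_opposite_face_proj) auto
  show p: "continuous_map (pointwise ?W) (pointwise (complex_carrier (vertex_link K v))) (opposite_face_proj v)"
    using contp proj by (fastforce simp: continuous_map_in_subtopology complex_carrier_def)
  have contm: "continuous_map (pointwise S) (powertop_real UNIV) mid" for S
    unfolding continuous_map_componentwise_UNIV
  proof
    fix w
    have "continuous_map (pointwise S) euclideanreal (\<lambda>y. y w / 2)"
      by (intro continuous_map_real_divide continuous_map_coordinate) auto
    then show "continuous_map (pointwise S) euclideanreal (\<lambda>y. mid y w)"
      by (cases "w = v") (auto simp: mid_def)
  qed
  have "mid y \<in> ?W" if "y \<in> complex_carrier (vertex_link K v)" for y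
  proof -
    obtain s where s: "s \<in> vertex_link K v" "y \<in> closed_simplex s"
      using \<open>y \<in> complex_carrier (vertex_link K v)\<close> by (auto simp: complex_carrier_def)
    then have "mid y \<in> closed_simplex (insert v s)" "insert v s \<in> K"
      using mid[OF s(2) simplicial_complex_onD(1)[OF simplicial_complex_vertex_link[OF K] s(1)]]
      by (auto simp: vertex_link_def)
    then show ?thesis
      by (auto simp: complex_carrier_def mid_def)
  qed
  then show m: "continuous_map (pointwise (complex_carrier (vertex_link K v))) (pointwise ?W) mid"
    using contm by (auto simp: continuous_map_in_subtopology)
  show "homotopic_with (\<lambda>_. True) (pointwise ?W) (pointwise ?W) (mid \<circ> opposite_face_proj v) id"
  proof (rule homotopic_straight_line[OF _ continuous_map_pointwise_ident])
    show "continuous_map (pointwise ?W) (powertop_real UNIV) (mid \<circ> opposite_face_proj v)"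
      by (rule continuous_map_compose[OF p contm])
    fix x and t :: real
    assume "x \<in> topspace (pointwise ?W)" and t: "0 \<le> t" "t \<le> 1"
    then obtain s where s: "s \<in> K" "x \<in> closed_simplex s" "0 < x v" "x v < 1"
      by (auto simp: complex_carrier_def)
    have "mid (opposite_face_proj v x) \<in> closed_simplex (insert v (s - {v}))"
      by (rule mid) (use proj[OF s] simplicial_complex_onD[OF K s(1)] in auto)
    then have "mid (opposite_face_proj v x) \<in> closed_simplex s"
      using proj(3)[OF s] by (simp add: insert_absorb)
    moreover have "0 < (1 - t) * (1 / 2) + t * x v" "(1 - t) * (1 / 2) + t * x v < 1"
    proof -
      show "0 < (1 - t) * (1 / 2) + t * x v"
        using t s(3) by (cases "t = 1") (auto intro: add_pos_nonneg)
      have "0 < (1 - t) * (1 / 2) + t * (1 - x v)"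
        using t s(4) by (cases "t = 1") (auto intro: add_pos_nonneg)
      then show "(1 - t) * (1 / 2) + t * x v < 1"
        by (simp add: field_simps)
    qed
    ultimately show "(\<lambda>w. (1 - t) * (mid \<circ> opposite_face_proj v) x w + t * id x w) \<in> ?W"
      using closed_simplex_convex[OF _ s(2) t] s(1) by (auto simp: complex_carrier_def mid_def)
  qed
qed

text \<open>\<open>card s \<le> p\<close> says that the dimension is below the degree, so passing to
  the link of a vertex lowers both by one, as Mayer-Vietoris demands. The induction runs over a set
  \<open>W\<close> containing the vertices, with \<open>K\<close> and \<open>p\<close> arbitrary, so
  as to apply to the link in degree \<open>p - 1\<close> and to the deletion in degree
  \<open>p\<close>.\<close>

lemma homology_vanishes_finite_complex:
  assumes "finite W" "simplicial_complex_on K" "\<Union>K \<subseteq> W" "\<And>s. s \<in> K \<Longrightarrow> card s \<le> p"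
  shows "homology_vanishes TYPE('g::ab_group_add) p (pointwise (complex_carrier K))"
  using assms
proof (induction W arbitrary: K p)
  case empty
  have "s = {}" if "s \<in> K" for s
    using empty.prems(2) that by blast
  then have "K = {}"
    using simplicial_complex_onD(2)[OF empty.prems(1)] by (metis ex_in_conv)
  then have "topspace (pointwise (complex_carrier K)) = {}"
    by (simp add: complex_carrier_def)
  then show ?case
    by (rule homology_vanishes_empty)
next
  case (insert v W K p)
  note K = insert.prems(1)
  show ?case
  proof (cases "{v} \<in> K")
    case False
    then have "v \<notin> \<Union>K"
      using simplicial_complex_onD(3)[OF K, of _ "{v}"] by blast
    then have "\<Union>K \<subseteq> W"
      using insert.prems(2) by blast
    then show ?thesis
      by (intro insert.IH[OF K] insert.prems(3))
  next
    case True
    \<comment> \<open>The simplex \<open>{v}\<close> has one element, so the bound allows degree 0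
      only for the empty complex.\<close>
    then have "1 \<le> p"
      using insert.prems(3)[OF True] by simp
    then obtain q where q: "p = Suc q"
      by (cases p) auto
    let ?A = "pointwise (complex_carrier K)"
    let ?U = "{x \<in> complex_carrier K. x v < 1}" and ?V = "{x \<in> complex_carrier K. 0 < x v}"
    have sub: "subtopology ?A S = pointwise S" if "S \<subseteq> complex_carrier K" for S
      using that by (simp add: subtopology_subtopology inf.absorb2)
    have UV: "openin ?A ?U" "openin ?A ?V"
      using openin_continuous_map_preimage[OF continuous_map_coordinate, of "{..<1}" "complex_carrier K" v]
        openin_continuous_map_preimage[OF continuous_map_coordinate, of "{0<..}" "complex_carrier K" v]
      by simp_all
    have card: "card s \<le> q" if "s \<in> vertex_link K v" for s
      using that insert.prems(3)[of "insert v s"] simplicial_complex_onD(1)[OF simplicial_complex_vertex_link[OF K] that]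
      by (auto simp: vertex_link_def q)
    have link: "\<Union> (vertex_link K v) \<subseteq> W" and deletion: "\<Union> (vertex_deletion K v) \<subseteq> W"
      using insert.prems(2) by (auto simp: vertex_link_def vertex_deletion_def)
    have "homology_vanishes TYPE('g) q (pointwise (complex_carrier (vertex_link K v)))"
      by (rule insert.IH[OF simplicial_complex_vertex_link[OF K] link card])
    note I = homology_vanishes_punctured_star[OF K this]
    have "homology_vanishes TYPE('g) p (pointwise (complex_carrier (vertex_deletion K v)))"
      by (rule insert.IH[OF simplicial_complex_vertex_deletion[OF K] deletion])
        (use insert.prems(3) in \<open>auto simp: vertex_deletion_def\<close>)
    note U = homology_vanishes_off_vertex[OF K this]
    have V: "homology_vanishes TYPE('g) p (pointwise ?V)"
      by (rule homology_vanishes_open_star[OF K True]) (simp add: q)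
    have UV_int: "?U \<inter> ?V = {x \<in> complex_carrier K. 0 < x v \<and> x v < 1}"
      by blast
    have "homology_vanishes TYPE('g) (Suc q) ?A"
    proof (rule mayer_vietoris_vanishing[OF UV])
      show "topspace ?A \<subseteq> ?U \<union> ?V"
        by force
      have "?U \<subseteq> complex_carrier K" "?V \<subseteq> complex_carrier K" "?U \<inter> ?V \<subseteq> complex_carrier K"
        by blast+
      note sub = this[THEN sub]
      show "homology_vanishes TYPE('g) (Suc q) (subtopology ?A ?U)"
        "homology_vanishes TYPE('g) (Suc q) (subtopology ?A ?V)"
        "homology_vanishes TYPE('g) q (subtopology ?A (?U \<inter> ?V))"
        unfolding sub using U V I by (simp_all only: q UV_int)
    qed
    then show ?thesis
      by (simp only: q)
  qed
qed

section \<open>The weak topology and its compact subsets\<close>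

lemma topspace_polyhedron [simp]: "topspace (polyhedron K) = complex_carrier K"
proof
  show "topspace (polyhedron K) \<subseteq> complex_carrier K"
    using openin_topspace[of "polyhedron K"] unfolding openin_polyhedron by blast
  have "complex_carrier K \<inter> closed_simplex s = closed_simplex s" if "s \<in> K" for s
    using that by (auto simp: complex_carrier_def)
  moreover have "openin (pointwise (closed_simplex s)) (closed_simplex s)" for s :: "'a set"
    by (metis openin_topspace topspace_subtopology_subset topspace_euclidean euclidean_product_topology top_greatest)
  ultimately have "openin (polyhedron K) (complex_carrier K)"
    by (simp add: openin_polyhedron)
  then show "complex_carrier K \<subseteq> topspace (polyhedron K)"
    by (rule openin_subset)
qed

lemma continuous_map_polyhedron_pointwise:
  "continuous_map (polyhedron K) (pointwise (complex_carrier K)) id"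
proof -
  have "openin (polyhedron K) {x \<in> complex_carrier K. x \<in> U}" if "openin (powertop_real UNIV) U" for U
  proof -
    have eq: "{x \<in> complex_carrier K. x \<in> U} \<inter> closed_simplex s = closed_simplex s \<inter> U" if "s \<in> K" for s
      using that by (auto simp: complex_carrier_def)
    show ?thesis
      using that by (auto simp: openin_polyhedron eq openin_subtopology_Int2)
  qed
  then have "continuous_map (polyhedron K) (powertop_real UNIV) id"
    by (simp add: continuous_map_def)
  then show ?thesis
    by (simp add: continuous_map_in_subtopology)
qed

lemma closedin_polyhedron:
  assumes "C \<subseteq> complex_carrier K"
    "\<And>s. s \<in> K \<Longrightarrow> closedin (pointwise (closed_simplex s)) (C \<inter> closed_simplex s)"
  shows "closedin (polyhedron K) C"
  unfolding closedin_def topspace_polyhedron openin_polyhedron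
proof (intro conjI ballI)
  fix s
  assume s: "s \<in> K"
  have "(complex_carrier K - C) \<inter> closed_simplex s = closed_simplex s - C \<inter> closed_simplex s"
    using s by (auto simp: complex_carrier_def)
  then show "openin (pointwise (closed_simplex s)) ((complex_carrier K - C) \<inter> closed_simplex s)"
    using assms(2)[OF s] by (simp add: closedin_def)
qed (use assms in auto)

lemma closedin_closed_simplex: "closedin (powertop_real UNIV) (closed_simplex s)"
proof -
  have "closed (closed_simplex s)"
    unfolding closed_simplex_def
    by (intro closed_Collect_conj closed_Collect_all closed_Collect_imp open_Collect_const
        closed_Collect_le closed_Collect_eq continuous_intros continuous_on_product_coordinates)
  then show ?thesis
    by (simp add: euclidean_product_topology)
qed

text \<open>A closed set of the polyhedron meets each closed simplex in a closed set of the product;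
  finiteness of \<open>L\<close> makes the union over its simplices closed. This returns fillings
  found in the product topology to the weak one.\<close>

lemma continuous_map_pointwise_polyhedron:
  assumes K: "simplicial_complex_on K" and L: "finite L" "L \<subseteq> K"
  shows "continuous_map (pointwise (complex_carrier L)) (polyhedron K) id"
  unfolding continuous_map_closedin
proof (intro conjI allI impI)
  fix C
  assume C: "closedin (polyhedron K) C"
  have "closedin (pointwise (complex_carrier L)) (C \<inter> closed_simplex s)" if s: "s \<in> L" for s
  proof -
    have "(complex_carrier K - C) \<inter> closed_simplex s = closed_simplex s - C"
      using s L by (auto simp: complex_carrier_def)
    moreover have "openin (pointwise (closed_simplex s)) ((complex_carrier K - C) \<inter> closed_simplex s)"
      using C s L(2) unfolding closedin_def topspace_polyhedron openin_polyhedron by blast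
    ultimately have "openin (pointwise (closed_simplex s)) (closed_simplex s - C)"
      by simp
    then have "closedin (pointwise (closed_simplex s)) (C \<inter> closed_simplex s)"
      by (simp add: closedin_def Diff_Int2 Diff_Int)
    moreover have "closedin (powertop_real UNIV) (closed_simplex s)"
      by (rule closedin_closed_simplex)
    ultimately have "closedin (powertop_real UNIV) (C \<inter> closed_simplex s)"
      using closedin_trans_full by blast
    then show ?thesis
      by (rule closedin_subset_topspace) (use s in \<open>auto simp: complex_carrier_def\<close>)
  qed
  then have "closedin (pointwise (complex_carrier L)) (\<Union>s\<in>L. C \<inter> closed_simplex s)"
    using L(1) by (intro closedin_Union) auto
  moreover have "(\<Union>s\<in>L. C \<inter> closed_simplex s) = {x \<in> topspace (pointwise (complex_carrier L)). id x \<in> C}"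
    by (auto simp: complex_carrier_def)
  ultimately show "closedin (pointwise (complex_carrier L)) {x \<in> topspace (pointwise (complex_carrier L)). id x \<in> C}"
    by simp
qed (use L in \<open>auto simp: complex_carrier_def\<close>)

text \<open>Choose one point of \<open>C\<close> for each support. A simplex has finitely many
  subsets, so it contains finitely many chosen points, and every set of chosen points is closed in
  the weak topology. An infinite choice would have no accumulation point, contrary to
  compactness.\<close>

lemma compactin_polyhedron_finite_supports:
  assumes K: "simplicial_complex_on K" and C: "compactin (polyhedron K) C"
  shows "finite ((\<lambda>x. {v. x v \<noteq> 0}) ` C)" (is "finite (?supp ` C)")
proof (rule ccontr)
  assume inf: "infinite (?supp ` C)"
  obtain D where D: "D \<subseteq> C" "inj_on ?supp D" "?supp ` C = ?supp ` D"
    using iffD1[OF subset_image_inj[of "?supp ` C" ?supp C] order_refl] by (elim exE conjE) (rule that)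
  have CK: "C \<subseteq> complex_carrier K"
    using compactin_subset_topspace[OF C] by simp
  have closed: "closedin (polyhedron K) T" if "T \<subseteq> D" for T
  proof (rule closedin_polyhedron)
    show "T \<subseteq> complex_carrier K"
      using that D(1) CK by (meson order_trans)
    fix s
    assume s: "s \<in> K"
    have "?supp ` (T \<inter> closed_simplex s) \<subseteq> Pow s"
      by (auto simp: closed_simplex_def)
    moreover have "inj_on ?supp (T \<inter> closed_simplex s)"
      by (rule inj_on_subset[OF D(2)]) (use that in blast)
    moreover have "finite (Pow s)"
      using simplicial_complex_onD(1)[OF K s] by simp
    ultimately have "finite (T \<inter> closed_simplex s)"
      by (metis finite_imageD finite_subset)
    moreover have "Hausdorff_space (pointwise (closed_simplex s))"
      by (intro Hausdorff_space_subtopology) (simp add: Hausdorff_space_product_topology)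
    ultimately show "closedin (pointwise (closed_simplex s)) (T \<inter> closed_simplex s)"
      by (intro closedin_Hausdorff_finite) auto
  qed
  have "infinite D"
    using inf unfolding D(3) by (rule contrapos_nn) (rule finite_imageI)
  then obtain x where x: "x \<in> polyhedron K derived_set_of D"
    using compactin_imp_Bolzano_Weierstrass[OF C, of D] D(1) by blast
  then have T: "x \<in> T \<Longrightarrow> openin (polyhedron K) T \<Longrightarrow> \<exists>y. y \<noteq> x \<and> y \<in> D \<and> y \<in> T" for T
    unfolding in_derived_set_of by simp
  \<comment> \<open>Removing the other chosen points leaves a neighbourhood of \<open>x\<close> that
    meets \<open>D\<close> in at most \<open>x\<close>.\<close>
  have "openin (polyhedron K) (complex_carrier K - (D - {x}))"
    using closed[of "D - {x}", OF Diff_subset] unfolding closedin_def topspace_polyhedron by (rule conjunct2)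
  moreover have "x \<in> complex_carrier K - (D - {x})"
    using x unfolding in_derived_set_of by simp
  ultimately have "\<exists>y. y \<noteq> x \<and> y \<in> D \<and> y \<in> complex_carrier K - (D - {x})"
    by (rule T[rotated])
  then show False
    by auto
qed

text \<open>The nonempty faces of the supports of points of \<open>C\<close> form the subcomplex. It
  is finite because only finitely many supports occur, each of them finite, and it covers
  \<open>C\<close> because a point lies in the simplex spanned by its support.\<close>

lemma compactin_polyhedron_finite_subcomplex:
  assumes K: "simplicial_complex_on K" and C: "compactin (polyhedron K) C"
  obtains L where "finite L" "L \<subseteq> K" "simplicial_complex_on L" "C \<subseteq> complex_carrier L"
proof
  let ?supp = "\<lambda>x. {v. x v \<noteq> (0::real)}"
  let ?L = "{t. t \<noteq> {} \<and> (\<exists>x\<in>C. t \<subseteq> ?supp x)}"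
  have supp: "?supp x \<in> K \<and> finite (?supp x) \<and> x \<in> closed_simplex (?supp x)" if x: "x \<in> C" for x
  proof -
    have "x \<in> complex_carrier K"
      using compactin_subset_topspace[OF C] x by auto
    then obtain s where s: "s \<in> K" "x \<in> closed_simplex s"
      by (auto simp: complex_carrier_def)
    then have sub: "?supp x \<subseteq> s"
      by (auto simp: closed_simplex_def)
    have fin: "finite s"
      using simplicial_complex_onD(1)[OF K s(1)] .
    have "sum x (?supp x) = sum x s"
      using sub fin by (intro sum.mono_neutral_left) auto
    then have *: "sum x (?supp x) = 1"
      using s(2) by (simp add: closed_simplex_def)
    then have "?supp x \<noteq> {}"
      by (metis sum.empty zero_neq_one)
    then show ?thesis
      using simplicial_complex_onD(3)[OF K s(1) sub] finite_subset[OF sub fin] s(2) *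
      by (simp add: closed_simplex_def)
  qed
  have "?L \<subseteq> (\<Union>s\<in>?supp ` C. Pow s)"
  proof
    fix t
    assume "t \<in> ?L"
    then obtain x where "x \<in> C" "t \<subseteq> ?supp x"
      by (elim CollectE conjE bexE) (rule that)
    then show "t \<in> (\<Union>s\<in>?supp ` C. Pow s)"
      by (intro UN_I[of "?supp x"] imageI PowI)
  qed
  moreover have "finite (\<Union>s\<in>?supp ` C. Pow s)"
  proof (intro finite_UN_I compactin_polyhedron_finite_supports[OF K C])
    fix s
    assume "s \<in> ?supp ` C"
    then obtain x where "x \<in> C" "s = ?supp x"
      by (rule imageE)
    then show "finite (Pow s)"
      using supp[of x] by simp
  qed
  ultimately show "finite ?L"
    by (rule finite_subset)
  show sub: "?L \<subseteq> K"
  proof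
    fix t
    assume "t \<in> ?L"
    then obtain x where "x \<in> C" "t \<subseteq> ?supp x" "t \<noteq> {}"
      by (elim CollectE conjE bexE) (rule that)
    then show "t \<in> K"
      using simplicial_complex_onD(3)[OF K, of "?supp x" t] supp[of x] by simp
  qed
  show "simplicial_complex_on ?L"
    unfolding simplicial_complex_on_def
  proof (intro ballI conjI allI impI)
    fix t u
    assume t: "t \<in> ?L"
    then show "finite t" "t \<noteq> {}"
      using simplicial_complex_onD(1)[OF K subsetD[OF sub t]] by simp_all
    assume u: "u \<subseteq> t" "u \<noteq> {}"
    obtain x where "x \<in> C" "t \<subseteq> ?supp x"
      using t by (elim CollectE conjE bexE) (rule that)
    then show "u \<in> ?L"
      using u by (intro CollectI conjI bexI[of _ x] order_trans[OF u(1)])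
  qed
  show "C \<subseteq> complex_carrier ?L"
  proof
    fix x
    assume x: "x \<in> C"
    then have "?supp x \<noteq> {}"
      using simplicial_complex_onD(2)[OF K, of "?supp x"] supp[OF x] by simp
    then have "?supp x \<in> ?L"
      using x by (intro CollectI conjI bexI[of _ x] order_refl)
    then show "x \<in> complex_carrier ?L"
      unfolding complex_carrier_def by (rule UN_I) (simp add: supp[OF x])
  qed
qed

theorem homology_vanishes_polyhedron:
  assumes K: "simplicial_complex_on K" "complex_dim_le K n" and k: "n < k"
  shows "homology_vanishes TYPE('g::ab_group_add) k (polyhedron K)"
  unfolding homology_vanishes_def
proof safe
  fix c :: "('a \<Rightarrow> real, 'g) gchain"
  assume c: "c \<in> gchains k (polyhedron K)" "gboundary k c = 0"
  let ?C = "\<Union>s\<in>Poly_Mapping.keys c. s ` standard_simplex k"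
  have "compactin (polyhedron K) (s ` standard_simplex k)" if "s \<in> Poly_Mapping.keys c" for s
  proof -
    have "continuous_map (std_simplex k) (polyhedron K) s"
      using c(1) that by (auto simp: gchains_def singular_simplex_std_simplex)
    moreover have "compactin (std_simplex k) (standard_simplex k)"
      by (simp add: std_simplex_def compactin_subtopology compactin_standard_simplex)
    ultimately show ?thesis
      by (rule image_compactin[rotated])
  qed
  then have "compactin (polyhedron K) ?C"
    by (intro compactin_Union) auto
  then obtain L where L: "finite L" "L \<subseteq> K" "simplicial_complex_on L" "?C \<subseteq> complex_carrier L"
    using compactin_polyhedron_finite_subcomplex[OF K(1)] by metis
  \<comment> \<open>The boundary operator does not mention a topology, so the same \<open>c\<close>
    remains a cycle for the product topology on the carrier of \<open>L\<close>.\<close>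
  have "c \<in> gchains k (subtopology (pointwise (complex_carrier K)) (complex_carrier L))"
    unfolding gchains_subtopology
    using gchain_map_in_gchains[OF c(1) continuous_map_polyhedron_pointwise] L(4)
    by (auto simp: gchain_map_id[OF c(1)] gchains_subtopology)
  then have cL: "c \<in> gchains k (pointwise (complex_carrier L))"
    by (auto simp: gchains_subtopology)
  have "homology_vanishes TYPE('g) k (pointwise (complex_carrier L))"
  proof (rule homology_vanishes_finite_complex[OF _ L(3) order_refl])
    show "finite (\<Union>L)"
      using L(1) simplicial_complex_onD(1)[OF L(3)] by blast
    show "card s \<le> k" if "s \<in> L" for s
      using K(2) that L(2) k by (fastforce simp: complex_dim_le_def)
  qed
  then have "c \<in> gboundaries k (pointwise (complex_carrier L))"
    using homology_vanishesD cL c(2) by blast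
  then have "gchain_map k id c \<in> gboundaries k (polyhedron K)"
    by (rule gchain_map_gboundaries[OF _ continuous_map_pointwise_polyhedron[OF K(1) L(1,2)]])
  then show "c \<in> gboundaries k (polyhedron K)"
    by (simp add: gchain_map_id[OF c(1)])
qed

section \<open>Functoriality on homotopy classes\<close>

abbreviation gcycles :: "nat \<Rightarrow> 'a topology \<Rightarrow> ('a, 'g::ab_group_add) gchain set" where
  "gcycles p A \<equiv> carrier (gcycle_group p A)"

lemma gcycles_iff: "c \<in> gcycles p A \<longleftrightarrow> c \<in> gchains p A \<and> gboundary p c = 0"
  by (simp add: gcycle_group_def)

lemma gcycle_group_simps [simp]:
  "x \<otimes>\<^bsub>gcycle_group p A\<^esub> y = x + y" "\<one>\<^bsub>gcycle_group p A\<^esub> = 0"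
  by (simp_all add: gcycle_group_def)

lemma comm_group_gcycle_group: "comm_group (gcycle_group p A)"
proof (rule comm_groupI)
  fix x :: "('a, 'b) gchain"
  assume "x \<in> gcycles p A"
  then show "\<exists>y\<in>gcycles p A. y \<otimes>\<^bsub>gcycle_group p A\<^esub> x = \<one>\<^bsub>gcycle_group p A\<^esub>"
    by (intro bexI[of _ "- x"]) (auto simp: gcycles_iff gboundary_uminus gchains_uminus)
qed (auto simp: gcycles_iff gboundary_add gchains_add add.assoc add.commute)

lemma inv_gcycle_group: "x \<in> gcycles p A \<Longrightarrow> inv\<^bsub>gcycle_group p A\<^esub> x = - x"
  by (rule group.inv_equality[OF comm_group.axioms(2)[OF comm_group_gcycle_group]])
    (auto simp: gcycles_iff gboundary_uminus gchains_uminus)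

lemma normal_gboundaries: "gboundaries p A \<lhd> gcycle_group p A"
proof (rule comm_group.subgroup_imp_normal[OF comm_group_gcycle_group])
  show "subgroup (gboundaries p A) (gcycle_group p A)"
    using gboundaries_cycle[of _ p A]
    by (auto simp: subgroup_def subset_iff gcycles_iff gboundaries_add inv_gcycle_group gboundaries_uminus)
qed

lemma group_ghomology: "group (ghomology p A)"
  unfolding ghomology_def by (rule normal.factorgroup_is_group[OF normal_gboundaries])

definition hclass :: "nat \<Rightarrow> 'a topology \<Rightarrow> ('a, 'g::ab_group_add) gchain \<Rightarrow> ('a, 'g) gchain set" where
  "hclass p A c = gboundaries p A #>\<^bsub>gcycle_group p A\<^esub> c"

lemma carrier_ghomology: "carrier (ghomology p A) = hclass p A ` gcycles p A"
  by (auto simp: ghomology_def FactGroup_def RCOSETS_def hclass_def)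

lemma one_ghomology: "\<one>\<^bsub>ghomology p A\<^esub> = gboundaries p A"
  by (simp add: ghomology_def FactGroup_def)

lemma hclass_0: "hclass p A 0 = gboundaries p A"
  by (simp add: hclass_def r_coset_def)

lemma in_hclass: "x \<in> hclass p A c \<longleftrightarrow> x - c \<in> gboundaries p A"
  by (auto simp: hclass_def r_coset_def intro: bexI[of _ "x - c"])

lemma hclass_eqI: "c - d \<in> gboundaries p A \<Longrightarrow> hclass p A c = hclass p A d"
  using gboundaries_add[of "_ - c" p A "c - d"] gboundaries_diff[of "_ - d" p A "c - d"]
  by (auto simp: in_hclass)

lemma hclass_mult:
  assumes "c \<in> gcycles p A" "d \<in> gcycles p A"
  shows "hclass p A c \<otimes>\<^bsub>ghomology p A\<^esub> hclass p A d = hclass p A (c + d)"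
  using normal.rcos_sum[OF normal_gboundaries assms]
  by (simp add: ghomology_def FactGroup_def hclass_def)

lemma gchain_map_gcycles:
  "c \<in> gcycles p A \<Longrightarrow> continuous_map A B f \<Longrightarrow> gchain_map p f c \<in> gcycles p B"
  by (auto simp: gcycles_iff gchain_map_in_gchains gboundary_gchain_map)

lemma hclass_in_carrier: "c \<in> gcycles p A \<Longrightarrow> hclass p A c \<in> carrier (ghomology p A)"
  by (simp add: carrier_ghomology)

text \<open>Boundaries go to boundaries under \<open>f\<close>, so the set product in
  \<open>ghom_map\<close> lies in one coset, and it fills that coset because \<open>c\<close>
  belongs to its own class. From here on induced maps are computed on representatives.\<close>

lemma ghom_map_hclass:
  assumes f: "continuous_map A B f" and c: "c \<in> gcycles p A"
  shows "ghom_map p A B f (hclass p A c) = hclass p B (gchain_map p f c)"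
proof -
  have "gboundaries p B <#>\<^bsub>gcycle_group p B\<^esub> gchain_map p f ` hclass p A c = hclass p B (gchain_map p f c)"
  proof safe
    fix x
    assume "x \<in> gboundaries p B <#>\<^bsub>gcycle_group p B\<^esub> gchain_map p f ` hclass p A c"
    then obtain b y where y: "b \<in> gboundaries p B" "y - c \<in> gboundaries p A" "x = b + gchain_map p f y"
      by (auto simp: set_mult_def in_hclass)
    then have "b + gchain_map p f (y - c) \<in> gboundaries p B"
      by (intro gboundaries_add gchain_map_gboundaries[OF _ f])
    then show "x \<in> hclass p B (gchain_map p f c)"
      by (simp add: in_hclass y(3) gchain_map_diff algebra_simps)
  next
    fix x
    assume "x \<in> hclass p B (gchain_map p f c)"
    then show "x \<in> gboundaries p B <#>\<^bsub>gcycle_group p B\<^esub> gchain_map p f ` hclass p A c"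
      unfolding set_mult_def in_hclass
      by (intro UN_I[of "x - gchain_map p f c"] UN_I[of "gchain_map p f c"] imageI) (auto simp: in_hclass)
  qed
  then show ?thesis
    by (simp add: ghom_map_def hclass_in_carrier[OF c])
qed

lemma ghom_map_hom:
  fixes A :: "'a topology"
  assumes f: "continuous_map A B f"
  shows "ghom_map p A B f \<in> hom (ghomology p A :: ('a, 'g::ab_group_add) gchain set monoid) (ghomology p B) \<inter>
    extensional (carrier (ghomology p A))"
proof
  show "ghom_map p A B f \<in> hom (ghomology p A :: ('a, 'g) gchain set monoid) (ghomology p B)"
  proof (rule homI)
    fix x y :: "('a, 'g) gchain set"
    assume "x \<in> carrier (ghomology p A)" "y \<in> carrier (ghomology p A)"
    then obtain c d :: "('a, 'g) gchain" where c: "c \<in> gcycles p A" "x = hclass p A c" and d: "d \<in> gcycles p A" "y = hclass p A d"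
      by (auto simp: carrier_ghomology)
    then have "c + d \<in> gcycles p A"
      by (simp add: gcycles_iff gchains_add gboundary_add)
    then show "ghom_map p A B f (x \<otimes>\<^bsub>ghomology p A\<^esub> y) =
        ghom_map p A B f x \<otimes>\<^bsub>ghomology p B\<^esub> ghom_map p A B f y"
      using c d by (simp add: hclass_mult ghom_map_hclass[OF f] gchain_map_gcycles[OF _ f] gchain_map_add)
    show "ghom_map p A B f x \<in> carrier (ghomology p B)"
      using c by (simp add: ghom_map_hclass[OF f] hclass_in_carrier gchain_map_gcycles[OF _ f])
  qed
  show "ghom_map p A B f \<in> extensional (carrier (ghomology p A :: ('a, 'g) gchain set monoid))"
    by (simp add: ghom_map_def)
qed

lemma ghom_map_homotopic:
  fixes A :: "'a topology"
  assumes "homotopic_with (\<lambda>_. True) A B f g"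
  shows "ghom_map p A B f = (ghom_map p A B g :: ('a, 'g::ab_group_add) gchain set \<Rightarrow> _)"
proof (rule extensionalityI[of _ "carrier (ghomology p A)"])
  have fg: "continuous_map A B f" "continuous_map A B g"
    using homotopic_with_imp_continuous_maps[OF assms] by auto
  fix x :: "('a, 'g) gchain set"
  assume "x \<in> carrier (ghomology p A)"
  then obtain c where c: "c \<in> gcycles p A" "x = hclass p A c"
    by (auto simp: carrier_ghomology)
  then show "ghom_map p A B f x = ghom_map p A B g x"
    using homotopic_gchain_map[OF assms, of c p]
    by (simp add: ghom_map_hclass fg gcycles_iff hclass_eqI)
qed (simp_all add: ghom_map_def)

text \<open>The representative picked by \<open>SOME\<close> is homotopic to \<open>f\<close>, and
  homotopic maps induce the same homomorphism, so the choice disappears.\<close>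

lemma ghom_hmap_class:
  assumes "continuous_map A B f"
  shows "ghom_hmap p A B (htpy_rel A B `` {f}) = ghom_map p A B f"
proof -
  have "f \<in> htpy_rel A B `` {f}"
    using assms by (simp add: htpy_rel_def)
  then have "(SOME g. g \<in> htpy_rel A B `` {f}) \<in> htpy_rel A B `` {f}"
    by (rule someI[where P = "\<lambda>g. g \<in> _"])
  then show ?thesis
    unfolding ghom_hmap_def by (intro ghom_map_homotopic[symmetric]) (simp add: htpy_rel_def)
qed

lemma ghom_hmap_hom:
  assumes "u \<in> hmaps A B"
  shows "ghom_hmap p A B u \<in> hom (ghomology p A) (ghomology p B) \<inter> extensional (carrier (ghomology p A))"
  using assms unfolding hmaps_htpy_class by (metis ghom_hmap_class ghom_map_hom)

lemma ghom_hmap_ident: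
  fixes A :: "'a topology"
  shows "ghom_hmap p A A (htpy_rel A A `` {id}) =
    (\<lambda>x\<in>carrier (ghomology p A :: ('a, 'g::ab_group_add) gchain set monoid). x)"
proof (rule extensionalityI[of _ "carrier (ghomology p A)"])
  fix x :: "('a, 'g) gchain set"
  assume "x \<in> carrier (ghomology p A)"
  then obtain c where "c \<in> gcycles p A" "x = hclass p A c"
    by (auto simp: carrier_ghomology)
  then show "ghom_hmap p A A (htpy_rel A A `` {id}) x = (\<lambda>x\<in>carrier (ghomology p A). x) x"
    by (auto simp: ghom_hmap_class ghom_map_hclass hclass_in_carrier gchain_map_id gcycles_iff)
qed (simp_all add: ghom_hmap_def ghom_map_def)

lemma ghom_hmap_hcomp:
  fixes A :: "'a topology"
  assumes "u \<in> hmaps A B" "v \<in> hmaps B C"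
  shows "ghom_hmap p A C (hcomp A B C v u) =
    compose (carrier (ghomology p A :: ('a, 'g::ab_group_add) gchain set monoid))
      (ghom_hmap p B C v) (ghom_hmap p A B u)"
proof -
  obtain f g where f: "continuous_map A B f" "u = htpy_rel A B `` {f}"
    and g: "continuous_map B C g" "v = htpy_rel B C `` {g}"
    using assms unfolding hmaps_htpy_class by blast
  have gf: "continuous_map A C (g \<circ> f)"
    by (rule continuous_map_compose[OF f(1) g(1)])
  show ?thesis
    unfolding f(2) g(2) hcomp_htpy_class[OF f(1) g(1)] ghom_hmap_class[OF gf]
      ghom_hmap_class[OF f(1)] ghom_hmap_class[OF g(1)]
  proof (rule extensionalityI[of _ "carrier (ghomology p A)"])
    fix x :: "('a, 'g) gchain set"
    assume "x \<in> carrier (ghomology p A)"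
    then obtain c where "c \<in> gcycles p A" "x = hclass p A c"
      by (auto simp: carrier_ghomology)
    then show "ghom_map p A C (g \<circ> f) x =
        compose (carrier (ghomology p A)) (ghom_map p B C g) (ghom_map p A B f) x"
      by (simp add: compose_def hclass_in_carrier ghom_map_hclass[OF gf] ghom_map_hclass[OF f(1)]
          ghom_map_hclass[OF g(1)] gchain_map_gcycles[OF _ f(1)] gchain_map_compose)
  qed (simp_all add: ghom_map_def compose_def)
qed

lemma carrier_ghomology_vanishing:
  fixes A :: "'a topology"
  assumes "homology_vanishes TYPE('g::ab_group_add) p A"
  shows "carrier (ghomology p A :: ('a, 'g) gchain set monoid) = {\<one>\<^bsub>ghomology p A\<^esub>}"
proof -
  have "hclass p A c = hclass p A 0" if "c \<in> gcycles p A" for c :: "('a, 'g) gchain"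
    using that homology_vanishesD[OF assms] by (intro hclass_eqI) (simp add: gcycles_iff)
  moreover have "(0 :: ('a, 'g) gchain) \<in> gcycles p A"
    by (simp add: gcycles_iff)
  ultimately show ?thesis
    unfolding carrier_ghomology one_ghomology hclass_0[symmetric] by blast
qed

text \<open>Restricted to the carrier because arrows of \<open>Grp\<close> are extensional; equality
  of arrows is then equality of functions.\<close>

definition zero_hom :: "'h monoid \<Rightarrow> 'h monoid \<Rightarrow> 'h \<Rightarrow> 'h" where
  "zero_hom A B = (\<lambda>x\<in>carrier A. \<one>\<^bsub>B\<^esub>)"

text \<open>The middle space has a point type of its own, since the polyhedron in
  \<open>sys_dim_le\<close> consists of functions on vertices and need not be a space of the
  category. For the same reason the homomorphisms are composed by \<open>compose\<close> and not
  inside \<open>Grp\<close>.\<close>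

lemma ghom_hmap_through_vanishing:
  fixes A C :: "'a topology" and B :: "'b topology"
  assumes "homology_vanishes TYPE('g::ab_group_add) p B" "u \<in> hmaps A B" "v \<in> hmaps B C"
  shows "ghom_hmap p A C (hcomp A B C v u) =
    zero_hom (ghomology p A :: ('a, 'g) gchain set monoid) (ghomology p C)"
proof -
  have "compose (carrier (ghomology p A)) (ghom_hmap p B C v) (ghom_hmap p A B u) =
      zero_hom (ghomology p A :: ('a, 'g) gchain set monoid) (ghomology p C)"
  proof (rule extensionalityI[of _ "carrier (ghomology p A)"])
    fix x :: "('a, 'g) gchain set"
    assume x: "x \<in> carrier (ghomology p A)"
    then have "ghom_hmap p A B u x \<in> carrier (ghomology p B)"
      using ghom_hmap_hom[OF assms(2), of p] by (auto simp: hom_def)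
    then have "ghom_hmap p A B u x = \<one>\<^bsub>ghomology p B\<^esub>"
      by (simp add: carrier_ghomology_vanishing[OF assms(1)])
    moreover have "ghom_hmap p B C v \<one>\<^bsub>ghomology p B\<^esub> = (\<one>\<^bsub>ghomology p C\<^esub> :: ('a, 'g) gchain set)"
      using ghom_hmap_hom[OF assms(3), of p] hom_one[OF _ group_ghomology group_ghomology] by blast
    ultimately show "compose (carrier (ghomology p A)) (ghom_hmap p B C v) (ghom_hmap p A B u) x =
        zero_hom (ghomology p A) (ghomology p C) x"
      using x by (simp add: compose_def zero_hom_def)
  qed (simp_all add: compose_def zero_hom_def)
  then show ?thesis
    by (simp add: ghom_hmap_hcomp[OF assms(2,3)])
qed

section \<open>Pro-groups\<close>

lemma is_categoryD:
  assumes "is_category C" "A \<in> Obj C" "B \<in> Obj C"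
  shows "\<And>D f g. D \<in> Obj C \<Longrightarrow> f \<in> Hom C A B \<Longrightarrow> g \<in> Hom C B D \<Longrightarrow> Comp C A B D g f \<in> Hom C A D"
    and "\<And>D E f g h. D \<in> Obj C \<Longrightarrow> E \<in> Obj C \<Longrightarrow> f \<in> Hom C A B \<Longrightarrow> g \<in> Hom C B D \<Longrightarrow> h \<in> Hom C D E \<Longrightarrow>
        Comp C A D E h (Comp C A B D g f) = Comp C A B E (Comp C B D E h g) f"
  using assms unfolding is_category_def by blast+

lemma inverse_systemD:
  assumes "inverse_system C X"
  shows "idx X \<noteq> {}"
    and "i \<in> idx X \<Longrightarrow> leq X i i"
    and "i \<in> idx X \<Longrightarrow> j \<in> idx X \<Longrightarrow> k \<in> idx X \<Longrightarrow> leq X i j \<Longrightarrow> leq X j k \<Longrightarrow> leq X i k"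
    and "i \<in> idx X \<Longrightarrow> j \<in> idx X \<Longrightarrow> \<exists>k\<in>idx X. leq X i k \<and> leq X j k"
    and "i \<in> idx X \<Longrightarrow> ob X i \<in> Obj C"
    and "i \<in> idx X \<Longrightarrow> j \<in> idx X \<Longrightarrow> leq X i j \<Longrightarrow> bond X i j \<in> Hom C (ob X j) (ob X i)"
    and "i \<in> idx X \<Longrightarrow> bond X i i = Ident C (ob X i)"
    and "i \<in> idx X \<Longrightarrow> j \<in> idx X \<Longrightarrow> k \<in> idx X \<Longrightarrow> leq X i j \<Longrightarrow> leq X j k \<Longrightarrow>
      Comp C (ob X k) (ob X j) (ob X i) (bond X i j) (bond X j k) = bond X i k"
  using assms unfolding inverse_system_def directed_set_def by blast+

lemma sys_morsD:
  assumes "r \<in> sys_mors C X Y" "\<mu> \<in> idx Y"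
  shows "snd r \<mu> \<in> idx X" "fst r \<mu> \<in> Hom C (ob X (snd r \<mu>)) (ob Y \<mu>)"
  using assms unfolding sys_mors_def by blast+

lemma shift_in_Hom:
  assumes "is_category C" "inverse_system C X" "inverse_system C Y" "r \<in> sys_mors C X Y"
    "\<mu> \<in> idx Y" "l \<in> idx X" "leq X (snd r \<mu>) l"
  shows "shift C X Y r \<mu> l \<in> Hom C (ob X l) (ob Y \<mu>)"
proof -
  note r = sys_morsD[OF assms(4,5)]
  show ?thesis
    unfolding shift_def
    by (rule is_categoryD(1)[OF assms(1) inverse_systemD(5)[OF assms(2,6)]
          inverse_systemD(5)[OF assms(2) r(1)] inverse_systemD(5)[OF assms(3,5)]
          inverse_systemD(6)[OF assms(2) r(1) assms(6,7)] r(2)])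
qed

text \<open>Associativity and the composition rule for bonding morphisms; this lets every equation
  between shifts be moved to a later index.\<close>

lemma shift_bond:
  assumes "is_category C" "inverse_system C X" "inverse_system C Y" "r \<in> sys_mors C X Y"
    "\<mu> \<in> idx Y" "l \<in> idx X" "l' \<in> idx X" "leq X (snd r \<mu>) l" "leq X l l'"
  shows "shift C X Y r \<mu> l' = Comp C (ob X l') (ob X l) (ob Y \<mu>) (shift C X Y r \<mu> l) (bond X l l')"
proof -
  note r = sys_morsD[OF assms(4,5)]
  have "Comp C (ob X l') (ob X (snd r \<mu>)) (ob Y \<mu>) (fst r \<mu>)
          (Comp C (ob X l') (ob X l) (ob X (snd r \<mu>)) (bond X (snd r \<mu>) l) (bond X l l')) =
        Comp C (ob X l') (ob X l) (ob Y \<mu>)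
          (Comp C (ob X l) (ob X (snd r \<mu>)) (ob Y \<mu>) (fst r \<mu>) (bond X (snd r \<mu>) l)) (bond X l l')"
    by (rule is_categoryD(2)[OF assms(1) inverse_systemD(5)[OF assms(2,7)] inverse_systemD(5)[OF assms(2,6)]
          inverse_systemD(5)[OF assms(2) r(1)] inverse_systemD(5)[OF assms(3,5)]
          inverse_systemD(6)[OF assms(2,6,7,9)] inverse_systemD(6)[OF assms(2) r(1) assms(6,8)] r(2)])
  then show ?thesis
    unfolding shift_def using inverse_systemD(8)[OF assms(2) r(1) assms(6,7,8,9)] by simp
qed

lemma shift_eq_mono:
  assumes "is_category C" "inverse_system C X" "inverse_system C Y" "r \<in> sys_mors C X Y" "r' \<in> sys_mors C X Y"
    "\<mu> \<in> idx Y" "l \<in> idx X" "l' \<in> idx X" "leq X (snd r \<mu>) l" "leq X (snd r' \<mu>) l" "leq X l l'"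
    "shift C X Y r \<mu> l = shift C X Y r' \<mu> l"
  shows "shift C X Y r \<mu> l' = shift C X Y r' \<mu> l'"
  using shift_bond[OF assms(1-4,6,7,8,9,11)] shift_bond[OF assms(1-3,5,6,7,8,10,11)] assms(12) by simp

text \<open>Transitivity is where directedness enters: the two agreements may occur at different
  indices of \<open>X\<close>, and both persist at a common later one.\<close>

lemma equiv_sys_rel:
  assumes C: "is_category C" "inverse_system C X" "inverse_system C Y"
  shows "equiv (sys_mors C X Y) (sys_rel C X Y)"
proof (rule equivI)
  show "sys_rel C X Y \<subseteq> sys_mors C X Y \<times> sys_mors C X Y"
    by (auto simp: sys_rel_def)
  show "refl_on (sys_mors C X Y) (sys_rel C X Y)"
    unfolding refl_on_def sys_rel_def using sys_morsD(1)[of _ C X Y] inverse_systemD(2)[OF C(2)] by fast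
  show "sym (sys_rel C X Y)"
    unfolding sym_def sys_rel_def by fastforce
  show "trans (sys_rel C X Y)"
  proof (rule transI)
    fix r s t
    assume rs: "(r, s) \<in> sys_rel C X Y" and st: "(s, t) \<in> sys_rel C X Y"
    then have m: "r \<in> sys_mors C X Y" "s \<in> sys_mors C X Y" "t \<in> sys_mors C X Y"
      by (auto simp: sys_rel_def)
    have "\<exists>l\<in>idx X. leq X (snd r \<mu>) l \<and> leq X (snd t \<mu>) l \<and> shift C X Y r \<mu> l = shift C X Y t \<mu> l"
      if \<mu>: "\<mu> \<in> idx Y" for \<mu>
    proof -
      note i = m[THEN sys_morsD(1)[OF _ \<mu>]]
      obtain a where a: "a \<in> idx X" "leq X (snd r \<mu>) a" "leq X (snd s \<mu>) a"
        "shift C X Y r \<mu> a = shift C X Y s \<mu> a"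
        using rs \<mu> unfolding sys_rel_def by blast
      obtain b where b: "b \<in> idx X" "leq X (snd s \<mu>) b" "leq X (snd t \<mu>) b"
        "shift C X Y s \<mu> b = shift C X Y t \<mu> b"
        using st \<mu> unfolding sys_rel_def by blast
      obtain l where l: "l \<in> idx X" "leq X a l" "leq X b l"
        using inverse_systemD(4)[OF C(2) a(1) b(1)] by blast
      have "shift C X Y r \<mu> l = shift C X Y s \<mu> l" "shift C X Y s \<mu> l = shift C X Y t \<mu> l"
        using shift_eq_mono[OF C m(1,2) \<mu> a(1) l(1) a(2,3) l(2) a(4)]
          shift_eq_mono[OF C m(2,3) \<mu> b(1) l(1) b(2,3) l(3) b(4)] by auto
      moreover have "leq X (snd r \<mu>) l" "leq X (snd t \<mu>) l"
        using inverse_systemD(3)[OF C(2) i(1) a(1) l(1) a(2) l(2)]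
          inverse_systemD(3)[OF C(2) i(3) b(1) l(1) b(3) l(3)] by auto
      ultimately show ?thesis
        using l(1) by auto
    qed
    then show "(r, t) \<in> sys_rel C X Y"
      using m unfolding sys_rel_def by blast
  qed
qed

lemma inverse_system_const_sys:
  assumes "is_category C" "A \<in> Obj C"
  shows "inverse_system C (const_sys C A)"
  using assms unfolding inverse_system_def directed_set_def const_sys_def is_category_def by auto

section \<open>Eventually vanishing morphisms of pro-groups\<close>

lemma zero_hom_in_Hom:
  assumes "group A" "group B"
  shows "zero_hom A B \<in> Hom Grp A B"
  using assms by (auto simp: Grp_def zero_hom_def hom_def group.is_monoid monoid.m_closed)

lemma Comp_zero_hom_right:
  assumes "f \<in> Hom Grp B D" "group B" "group D"
  shows "Comp Grp A B D f (zero_hom A B) = zero_hom A D"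
proof -
  have "f \<one>\<^bsub>B\<^esub> = \<one>\<^bsub>D\<^esub>"
    using hom_one[of f B D] assms by (simp add: Grp_def)
  then show ?thesis
    by (auto simp: Grp_def zero_hom_def compose_def)
qed

lemma Comp_zero_hom_left:
  assumes "f \<in> Hom Grp A B"
  shows "Comp Grp A B D (zero_hom B D) f = zero_hom A D"
  using assms by (auto simp: Grp_def zero_hom_def compose_def hom_def Pi_iff intro!: restrict_ext)

text \<open>A zero-morphism described without a trivial group. The index at which a component dies
  may depend on \<open>\<mu>\<close>, just as in the factorisations of
  \<open>sys_dim_le\<close>.\<close>

definition eventually_zero ::
  "('i, 'h monoid, 'h \<Rightarrow> 'h) inv_sys \<Rightarrow> ('j, 'h monoid, 'h \<Rightarrow> 'h) inv_sys \<Rightarrow>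
   ('i, 'j, 'h \<Rightarrow> 'h) sys_map \<Rightarrow> bool" where
  "eventually_zero X Y r \<longleftrightarrow> (\<forall>\<mu>\<in>idx Y. \<exists>l\<in>idx X. leq X (snd r \<mu>) l \<and>
     shift Grp X Y r \<mu> l = zero_hom (ob X l) (ob Y \<mu>))"

lemma shift_zero_mono:
  assumes XY: "inverse_system Grp X" "inverse_system Grp Y" and r: "r \<in> sys_mors Grp X Y"
    and l: "\<mu> \<in> idx Y" "l \<in> idx X" "l' \<in> idx X" "leq X (snd r \<mu>) l" "leq X l l'"
    and z: "shift Grp X Y r \<mu> l = zero_hom (ob X l) (ob Y \<mu>)"
  shows "shift Grp X Y r \<mu> l' = zero_hom (ob X l') (ob Y \<mu>)"
  unfolding shift_bond[OF is_category_Grp XY r l] z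
  by (rule Comp_zero_hom_left) (use inverse_systemD(6)[OF XY(1)] l in auto)

text \<open>The two maps may use different index functions; at a common later index both shifts are
  the zero homomorphism, so they represent the same pro-morphism.\<close>

lemma eventually_zero_sys_rel:
  assumes XY: "inverse_system Grp X" "inverse_system Grp Y"
    and r: "r \<in> sys_mors Grp X Y" "eventually_zero X Y r"
    and s: "s \<in> sys_mors Grp X Y" "eventually_zero X Y s"
  shows "(r, s) \<in> sys_rel Grp X Y"
proof -
  have "\<exists>l\<in>idx X. leq X (snd r \<mu>) l \<and> leq X (snd s \<mu>) l \<and> shift Grp X Y r \<mu> l = shift Grp X Y s \<mu> l"
    if \<mu>: "\<mu> \<in> idx Y" for \<mu>
  proof -
    note i = r(1)[THEN sys_morsD(1)[OF _ \<mu>]] s(1)[THEN sys_morsD(1)[OF _ \<mu>]]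
    obtain a where a: "a \<in> idx X" "leq X (snd r \<mu>) a" "shift Grp X Y r \<mu> a = zero_hom (ob X a) (ob Y \<mu>)"
      using r(2) \<mu> unfolding eventually_zero_def by blast
    obtain b where b: "b \<in> idx X" "leq X (snd s \<mu>) b" "shift Grp X Y s \<mu> b = zero_hom (ob X b) (ob Y \<mu>)"
      using s(2) \<mu> unfolding eventually_zero_def by blast
    obtain l where l: "l \<in> idx X" "leq X a l" "leq X b l"
      using inverse_systemD(4)[OF XY(1) a(1) b(1)] by blast
    have "shift Grp X Y r \<mu> l = shift Grp X Y s \<mu> l"
      using shift_zero_mono[OF XY r(1) \<mu> a(1) l(1) a(2) l(2) a(3)]
        shift_zero_mono[OF XY s(1) \<mu> b(1) l(1) b(2) l(3) b(3)] by simp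
    moreover have "leq X (snd r \<mu>) l" "leq X (snd s \<mu>) l"
      using inverse_systemD(3)[OF XY(1) i(1) a(1) l(1) a(2) l(2)]
        inverse_systemD(3)[OF XY(1) i(2) b(1) l(1) b(2) l(3)] by auto
    ultimately show ?thesis
      using l(1) by auto
  qed
  then show ?thesis
    using r(1) s(1) unfolding sys_rel_def by blast
qed

lemma group_ob: "inverse_system Grp X \<Longrightarrow> i \<in> idx X \<Longrightarrow> group (ob X i)"
  using inverse_systemD(5)[of Grp X i] by (simp add: Grp_def)

text \<open>Composing a zero homomorphism with any homomorphism gives a zero homomorphism, so the
  compatibility squares commute at every common index, whatever the index function is.\<close>

lemma zero_sys_map:
  assumes XY: "inverse_system Grp X" "inverse_system Grp Y"
    and r: "\<And>\<mu>. \<mu> \<in> idx Y \<Longrightarrow> snd r \<mu> \<in> idx X"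
      "\<And>\<mu>. \<mu> \<in> idx Y \<Longrightarrow> fst r \<mu> = zero_hom (ob X (snd r \<mu>)) (ob Y \<mu>)"
  shows "r \<in> sys_mors Grp X Y" "eventually_zero X Y r"
proof -
  have z: "shift Grp X Y r \<mu> l = zero_hom (ob X l) (ob Y \<mu>)"
    if "\<mu> \<in> idx Y" "l \<in> idx X" "leq X (snd r \<mu>) l" for \<mu> l
    unfolding shift_def r(2)[OF that(1)]
    by (rule Comp_zero_hom_left) (use inverse_systemD(6)[OF XY(1) r(1)] that in auto)
  show "r \<in> sys_mors Grp X Y"
    unfolding sys_mors_def
  proof (intro CollectI conjI ballI impI)
    fix \<mu>
    assume \<mu>: "\<mu> \<in> idx Y"
    show "snd r \<mu> \<in> idx X"
      using r(1) \<mu> .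
    show "fst r \<mu> \<in> Hom Grp (ob X (snd r \<mu>)) (ob Y \<mu>)"
      using r \<mu> zero_hom_in_Hom group_ob XY by metis
    fix \<mu>'
    assume \<mu>': "\<mu>' \<in> idx Y" "leq Y \<mu> \<mu>'"
    obtain l where l: "l \<in> idx X" "leq X (snd r \<mu>) l" "leq X (snd r \<mu>') l"
      using inverse_systemD(4)[OF XY(1) r(1)[OF \<mu>] r(1)[OF \<mu>'(1)]] by blast
    have "Comp Grp (ob X l) (ob Y \<mu>') (ob Y \<mu>) (bond Y \<mu> \<mu>') (zero_hom (ob X l) (ob Y \<mu>')) =
        zero_hom (ob X l) (ob Y \<mu>)"
      using inverse_systemD(6)[OF XY(2) \<mu> \<mu>'] group_ob[OF XY(2)] \<mu> \<mu>'(1) by (intro Comp_zero_hom_right) auto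
    then show "\<exists>l\<in>idx X. leq X (snd r \<mu>) l \<and> leq X (snd r \<mu>') l \<and> shift Grp X Y r \<mu> l =
        Comp Grp (ob X l) (ob Y \<mu>') (ob Y \<mu>) (bond Y \<mu> \<mu>') (shift Grp X Y r \<mu>' l)"
      using l z \<mu> \<mu>'(1) by (intro bexI[of _ l]) auto
  qed
  show "eventually_zero X Y r"
    unfolding eventually_zero_def using z r(1) inverse_systemD(2)[OF XY(1)] by blast
qed

lemma pro_morsE:
  assumes "is_category C" "inverse_system C X" "inverse_system C Y" "f \<in> pro_mors C X Y" "r \<in> f"
  shows "r \<in> sys_mors C X Y" "s \<in> f \<Longrightarrow> (s, r) \<in> sys_rel C X Y"
  using assms(4,5) equiv_sys_rel[OF assms(1-3)] unfolding pro_mors_def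
  by (meson in_quotient_imp_subset subsetD, meson quotient_eq_iff)

lemma class_in_pro_mors:
  assumes "is_category C" "inverse_system C X" "inverse_system C Y" "r \<in> sys_mors C X Y"
  shows "sys_rel C X Y `` {r} \<in> pro_mors C X Y" "r \<in> sys_rel C X Y `` {r}"
  using assms(4) equiv_class_self[OF equiv_sys_rel[OF assms(1-3)]] unfolding pro_mors_def
  by (auto intro: quotientI)

text \<open>The morphism is given as a union over a set \<open>R\<close> of maps, in the shape of
  \<open>homology_pro\<close>. As all of them vanish eventually, they lie in one class, and so does
  every composite through the trivial group.\<close>

lemma zero_pro_morphismI:
  fixes X :: "('i, 'h monoid, 'h \<Rightarrow> 'h) inv_sys" and Y :: "('j, 'h monoid, 'h \<Rightarrow> 'h) inv_sys"
  assumes XY: "inverse_system Grp X" "inverse_system Grp Y"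
    and R: "R \<noteq> {}" "\<And>r. r \<in> R \<Longrightarrow> r \<in> sys_mors Grp X Y \<and> eventually_zero X Y r"
  shows "zero_pro_morphism X Y (\<Union>r\<in>R. sys_rel Grp X Y `` {r})"
proof -
  \<comment> \<open>All objects of \<open>Grp\<close> share one element type, so the trivial group
    is built on an arbitrary element of it.\<close>
  define T :: "'h monoid" where "T = singleton_group undefined"
  let ?T = "const_sys Grp T"
  have T: "trivial_group T" "group T"
    by (simp_all add: T_def)
  have XT: "inverse_system Grp ?T"
    by (rule inverse_system_const_sys[OF is_category_Grp]) (simp add: Grp_def T)
  have T_idx: "idx ?T = {()}" "ob ?T = (\<lambda>_. T)"
    by (simp_all add: const_sys_def)
  \<comment> \<open>Any index of \<open>X\<close> can carry the map into the one-point
    system.\<close>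
  obtain i where i: "i \<in> idx X"
    using inverse_systemD(1)[OF XY(1)] by blast
  define u where "u = (\<lambda>_::unit. zero_hom (ob X i) T, \<lambda>_::unit. i)"
  define v where "v = (\<lambda>\<mu>. zero_hom T (ob Y \<mu>), \<lambda>_::'j. ())"
  have u: "u \<in> sys_mors Grp X ?T"
    by (rule zero_sys_map(1)[OF XY(1) XT]) (simp_all add: u_def i T_idx)
  have v: "v \<in> sys_mors Grp ?T Y"
    by (rule zero_sys_map(1)[OF XT XY(2)]) (simp_all add: v_def T_idx)
  let ?u = "sys_rel Grp X ?T `` {u}" and ?v = "sys_rel Grp ?T Y `` {v}"
  note u' = class_in_pro_mors[OF is_category_Grp XY(1) XT u]
  note v' = class_in_pro_mors[OF is_category_Grp XT XY(2) v]
  \<comment> \<open>\<open>pro_comp\<close> ranges over all representatives, not only over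
    \<open>u\<close> and \<open>v\<close>. This is harmless since a homomorphism into the trivial
    group is always zero.\<close>
  have comp: "sys_comp Grp X ?T Y s r \<in> sys_mors Grp X Y \<and> eventually_zero X Y (sys_comp Grp X ?T Y s r)"
    if "s \<in> ?v" "r \<in> ?u" for s r
  proof -
    have s: "s \<in> sys_mors Grp ?T Y" and r: "r \<in> sys_mors Grp X ?T"
      using pro_morsE(1)[OF is_category_Grp XT XY(2) v'(1) that(1)]
        pro_morsE(1)[OF is_category_Grp XY(1) XT u'(1) that(2)] .
    have "Comp Grp (ob X (snd r ())) T (ob Y \<nu>) (fst s \<nu>) (fst r ()) = zero_hom (ob X (snd r ())) (ob Y \<nu>)"
      if \<nu>: "\<nu> \<in> idx Y" for \<nu>
    proof -
      have "fst r () \<in> Hom Grp (ob X (snd r ())) T"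
        using sys_morsD(2)[OF r, of "()"] by (simp add: T_idx)
      then have "fst r () = zero_hom (ob X (snd r ())) T"
        using T(1) by (auto simp: Grp_def zero_hom_def trivial_group_def hom_def
            intro!: extensionalityI[of _ "carrier (ob X (snd r ()))"])
      moreover have "fst s \<nu> \<in> Hom Grp T (ob Y \<nu>)"
        using sys_morsD(2)[OF s \<nu>] by (simp add: T_idx)
      ultimately show ?thesis
        using Comp_zero_hom_right T(2) group_ob[OF XY(2) \<nu>] by metis
    qed
    moreover have "snd r () \<in> idx X"
      using sys_morsD(1)[OF r, of "()"] by (simp add: T_idx)
    ultimately show ?thesis
      by (intro conjI zero_sys_map[OF XY]) (simp_all add: sys_comp_def T_idx)
  qed
  define z where "z = sys_comp Grp X ?T Y v u"
  have z: "z \<in> sys_mors Grp X Y" "eventually_zero X Y z"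
    using comp[OF v'(2) u'(2)] by (simp_all add: z_def)
  have class_z: "sys_rel Grp X Y `` {r} = sys_rel Grp X Y `` {z}"
    if "r \<in> sys_mors Grp X Y" "eventually_zero X Y r" for r
    by (rule equiv_class_eq[OF equiv_sys_rel[OF is_category_Grp XY]])
      (rule eventually_zero_sys_rel[OF XY that z])
  have "(\<Union>r\<in>R. sys_rel Grp X Y `` {r}) = sys_rel Grp X Y `` {z}"
    using R class_z by blast
  moreover have "pro_comp Grp X ?T Y ?v ?u = sys_rel Grp X Y `` {z}"
  proof -
    have "sys_rel Grp X Y `` {sys_comp Grp X ?T Y s r} = sys_rel Grp X Y `` {z}"
      if "s \<in> ?v" "r \<in> ?u" for s r
      using comp[OF that] class_z by blast
    then show ?thesis
      unfolding pro_comp_def using u'(2) v'(2) by blast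
  qed
  ultimately show ?thesis
    unfolding zero_pro_morphism_def using T(1) u'(1) v'(1) by metis
qed

section \<open>Homology of inverse systems and of their morphisms\<close>

lemma HPol_simps [simp]:
  "Hom (HPol V) = hmaps" "Comp (HPol V) = hcomp" "Ident (HPol V) A = htpy_rel A A `` {id}"
  by (simp_all add: HPol_def HTop_def)

lemma homology_sys_simps [simp]:
  "idx (homology_sys G k X) = idx X" "leq (homology_sys G k X) = leq X"
  "ob (homology_sys G k X) l = ghomology k (ob X l)"
  "bond (homology_sys G k X) l l' = ghom_hmap k (ob X l') (ob X l) (bond X l l')"
  by (simp_all add: homology_sys_def)

lemma Grp_simps [simp]:
  "A \<in> Obj Grp \<longleftrightarrow> group A" "Hom Grp A B = hom A B \<inter> extensional (carrier A)"
  "Comp Grp A B D g f = compose (carrier A) g f" "Ident Grp A = (\<lambda>x\<in>carrier A. x)"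
  by (simp_all add: Grp_def)

lemma inverse_system_homology_sys:
  fixes X :: "('i, 'a topology, ('a \<Rightarrow> 'a) set) inv_sys"
  assumes X: "inverse_system (HPol V) X"
  shows "inverse_system Grp (homology_sys TYPE('g::ab_group_add) k X)"
  unfolding inverse_system_def
proof (intro conjI ballI impI)
  show "directed_set (idx (homology_sys TYPE('g) k X)) (leq (homology_sys TYPE('g) k X))"
    using X by (simp add: inverse_system_def)
next
  fix i assume "i \<in> idx (homology_sys TYPE('g) k X)"
  then show "bond (homology_sys TYPE('g) k X) i i = Ident Grp (ob (homology_sys TYPE('g) k X) i)"
    using inverse_systemD(7)[OF X] by (simp add: ghom_hmap_ident)
next
  fix i j assume "i \<in> idx (homology_sys TYPE('g) k X)" "j \<in> idx (homology_sys TYPE('g) k X)"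
    "leq (homology_sys TYPE('g) k X) i j"
  then show "bond (homology_sys TYPE('g) k X) i j \<in>
      Hom Grp (ob (homology_sys TYPE('g) k X) j) (ob (homology_sys TYPE('g) k X) i)"
    using inverse_systemD(6)[OF X, of i j] ghom_hmap_hom by simp
next
  fix i j l
  assume "i \<in> idx (homology_sys TYPE('g) k X)" "j \<in> idx (homology_sys TYPE('g) k X)"
    "l \<in> idx (homology_sys TYPE('g) k X)"
    "leq (homology_sys TYPE('g) k X) i j" "leq (homology_sys TYPE('g) k X) j l"
  then have ij: "bond X i j \<in> hmaps (ob X j) (ob X i)" "bond X j l \<in> hmaps (ob X l) (ob X j)"
    and eq: "hcomp (ob X l) (ob X j) (ob X i) (bond X i j) (bond X j l) = bond X i l"
    using inverse_systemD(6)[OF X] inverse_systemD(8)[OF X] by simp_all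
  show "Comp Grp (ob (homology_sys TYPE('g) k X) l) (ob (homology_sys TYPE('g) k X) j)
      (ob (homology_sys TYPE('g) k X) i) (bond (homology_sys TYPE('g) k X) i j)
      (bond (homology_sys TYPE('g) k X) j l) = bond (homology_sys TYPE('g) k X) i l"
    by (simp add: ghom_hmap_hcomp[OF ij(2,1), symmetric] eq)
qed (simp add: group_ghomology)

lemma homology_sys_map_simps [simp]:
  "fst (homology_sys_map G k X Y r) \<mu> = ghom_hmap k (ob X (snd r \<mu>)) (ob Y \<mu>) (fst r \<mu>)"
  "snd (homology_sys_map G k X Y r) = snd r"
  by (simp_all add: homology_sys_map_def)

text \<open>Functoriality of homology, in the form that turns a factorisation of a shift of
  \<open>r\<close> into one of the induced shift.\<close>

lemma shift_homology_sys_map: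
  assumes X: "inverse_system (HPol V) X" and r: "r \<in> sys_mors (HPol V) X Y"
    and l: "\<mu> \<in> idx Y" "l \<in> idx X" "leq X (snd r \<mu>) l"
  shows "shift Grp (homology_sys TYPE('g::ab_group_add) k X) (homology_sys TYPE('g) k Y)
      (homology_sys_map TYPE('g) k X Y r) \<mu> l =
    ghom_hmap k (ob X l) (ob Y \<mu>) (shift (HPol V) X Y r \<mu> l)"
proof -
  have "bond X (snd r \<mu>) l \<in> hmaps (ob X l) (ob X (snd r \<mu>))"
    "fst r \<mu> \<in> hmaps (ob X (snd r \<mu>)) (ob Y \<mu>)"
    using sys_morsD[OF r l(1)] inverse_systemD(6)[OF X _ l(2,3)] by simp_all
  then show ?thesis
    by (simp add: shift_def ghom_hmap_hcomp)
qed

lemma homology_sys_map_in_sys_mors: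
  assumes X: "inverse_system (HPol V) X" and Y: "inverse_system (HPol V) Y"
    and r: "r \<in> sys_mors (HPol V) X Y"
  shows "homology_sys_map TYPE('g::ab_group_add) k X Y r \<in>
    sys_mors Grp (homology_sys TYPE('g) k X) (homology_sys TYPE('g) k Y)"
  unfolding sys_mors_def
proof (intro CollectI conjI ballI impI)
  fix \<mu>
  assume "\<mu> \<in> idx (homology_sys TYPE('g) k Y)"
  then have \<mu>: "\<mu> \<in> idx Y"
    by simp
  show "snd (homology_sys_map TYPE('g) k X Y r) \<mu> \<in> idx (homology_sys TYPE('g) k X)"
    using sys_morsD(1)[OF r \<mu>] by simp
  show "fst (homology_sys_map TYPE('g) k X Y r) \<mu> \<in>
      Hom Grp (ob (homology_sys TYPE('g) k X) (snd (homology_sys_map TYPE('g) k X Y r) \<mu>))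
        (ob (homology_sys TYPE('g) k Y) \<mu>)"
    using sys_morsD(2)[OF r \<mu>] ghom_hmap_hom by simp
  fix \<mu>'
  assume "\<mu>' \<in> idx (homology_sys TYPE('g) k Y)" "leq (homology_sys TYPE('g) k Y) \<mu> \<mu>'"
  then have \<mu>': "\<mu>' \<in> idx Y" "leq Y \<mu> \<mu>'"
    by simp_all
  then obtain l where l: "l \<in> idx X" "leq X (snd r \<mu>) l" "leq X (snd r \<mu>') l"
    "shift (HPol V) X Y r \<mu> l = hcomp (ob X l) (ob Y \<mu>') (ob Y \<mu>) (bond Y \<mu> \<mu>') (shift (HPol V) X Y r \<mu>' l)"
    using r \<mu> unfolding sys_mors_def HPol_simps by blast
  have "shift (HPol V) X Y r \<mu>' l \<in> hmaps (ob X l) (ob Y \<mu>')" "bond Y \<mu> \<mu>' \<in> hmaps (ob Y \<mu>') (ob Y \<mu>)"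
    using shift_in_Hom[OF is_category_HPol X Y r \<mu>'(1) l(1,3)] inverse_systemD(6)[OF Y \<mu> \<mu>'] by simp_all
  then show "\<exists>l\<in>idx (homology_sys TYPE('g) k X).
      leq (homology_sys TYPE('g) k X) (snd (homology_sys_map TYPE('g) k X Y r) \<mu>) l \<and>
      leq (homology_sys TYPE('g) k X) (snd (homology_sys_map TYPE('g) k X Y r) \<mu>') l \<and>
      shift Grp (homology_sys TYPE('g) k X) (homology_sys TYPE('g) k Y) (homology_sys_map TYPE('g) k X Y r) \<mu> l =
      Comp Grp (ob (homology_sys TYPE('g) k X) l) (ob (homology_sys TYPE('g) k Y) \<mu>')
        (ob (homology_sys TYPE('g) k Y) \<mu>) (bond (homology_sys TYPE('g) k Y) \<mu> \<mu>')
        (shift Grp (homology_sys TYPE('g) k X) (homology_sys TYPE('g) k Y) (homology_sys_map TYPE('g) k X Y r) \<mu>' l)"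
    using l \<mu> \<mu>' by (intro bexI[of _ l])
      (simp_all add: shift_homology_sys_map[OF X r] ghom_hmap_hcomp)
qed

text \<open>The dimension bound concerns one representative \<open>s\<close>, while \<open>r\<close>
  is an arbitrary equivalent one. The factorisation of \<open>s\<close> holds at some index
  \<open>b\<close> and the agreement of \<open>r\<close> and \<open>s\<close> at some
  \<open>a\<close>; vanishing and agreement both persist at a common later index.\<close>

lemma eventually_zero_homology_sys_map:
  fixes X :: "('i, 'a topology, ('a \<Rightarrow> 'a) set) inv_sys"
  assumes X: "inverse_system (HPol TYPE('v)) X" and Y: "inverse_system (HPol TYPE('v)) Y"
    and rs: "(r, s) \<in> sys_rel (HPol TYPE('v)) X Y" and s: "sys_dim_le TYPE('v) X Y s n" and k: "n < k"
  shows "eventually_zero (homology_sys TYPE('g::ab_group_add) k X) (homology_sys TYPE('g) k Y)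
    (homology_sys_map TYPE('g) k X Y r)"
  unfolding eventually_zero_def
proof
  note C = is_category_HPol[of "TYPE('v)"] X Y
  have m: "r \<in> sys_mors (HPol TYPE('v)) X Y" "s \<in> sys_mors (HPol TYPE('v)) X Y"
    using rs by (auto simp: sys_rel_def)
  note HXY = inverse_system_homology_sys[OF X] inverse_system_homology_sys[OF Y]
  let ?shift = "shift (HPol TYPE('v)) X Y"
  fix \<mu>
  assume "\<mu> \<in> idx (homology_sys TYPE('g) k Y)"
  then have \<mu>: "\<mu> \<in> idx Y"
    by simp
  obtain a where a: "a \<in> idx X" "leq X (snd r \<mu>) a" "leq X (snd s \<mu>) a" "?shift r \<mu> a = ?shift s \<mu> a"
    using rs \<mu> unfolding sys_rel_def by blast
  obtain b and K :: "'v set set" and u v where b: "b \<in> idx X" "leq X (snd s \<mu>) b"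
    and K: "simplicial_complex_on K" "complex_dim_le K n"
    and uv: "u \<in> hmaps (ob X b) (polyhedron K)" "v \<in> hmaps (polyhedron K) (ob Y \<mu>)"
    and eq: "?shift s \<mu> b = hcomp (ob X b) (polyhedron K) (ob Y \<mu>) v u"
    using bspec[OF s[unfolded sys_dim_le_def] \<mu>] by (elim bexE conjE exE) (rule that)
  obtain l where l: "l \<in> idx X" "leq X a l" "leq X b l"
    using inverse_systemD(4)[OF X a(1) b(1)] by blast
  have rl: "leq X (snd r \<mu>) l" and sl: "leq X (snd s \<mu>) l"
    using inverse_systemD(3)[OF X sys_morsD(1)[OF m(1) \<mu>] a(1) l(1) a(2) l(2)]
      inverse_systemD(3)[OF X sys_morsD(1)[OF m(2) \<mu>] b(1) l(1) b(2) l(3)] by simp_all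
  have "ghom_hmap k (ob X b) (ob Y \<mu>) (?shift s \<mu> b) =
      zero_hom (ghomology k (ob X b) :: ('a, 'g) gchain set monoid) (ghomology k (ob Y \<mu>))"
    unfolding eq by (rule ghom_hmap_through_vanishing[OF homology_vanishes_polyhedron[OF K k] uv])
  then have z: "shift Grp (homology_sys TYPE('g) k X) (homology_sys TYPE('g) k Y)
      (homology_sys_map TYPE('g) k X Y s) \<mu> b =
    zero_hom (ob (homology_sys TYPE('g) k X) b) (ob (homology_sys TYPE('g) k Y) \<mu>)"
    by (simp add: shift_homology_sys_map[OF X m(2) \<mu> b])
  have "shift Grp (homology_sys TYPE('g) k X) (homology_sys TYPE('g) k Y)
      (homology_sys_map TYPE('g) k X Y s) \<mu> l =
    zero_hom (ob (homology_sys TYPE('g) k X) l) (ob (homology_sys TYPE('g) k Y) \<mu>)"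
    by (rule shift_zero_mono[OF HXY homology_sys_map_in_sys_mors[OF X Y m(2)] _ _ _ _ _ z])
      (simp_all add: b l \<mu>)
  moreover have "?shift r \<mu> l = ?shift s \<mu> l"
    by (rule shift_eq_mono[OF C m \<mu> a(1) l(1) a(2,3) l(2) a(4)])
  ultimately show "\<exists>l\<in>idx (homology_sys TYPE('g) k X).
      leq (homology_sys TYPE('g) k X) (snd (homology_sys_map TYPE('g) k X Y r) \<mu>) l \<and>
      shift Grp (homology_sys TYPE('g) k X) (homology_sys TYPE('g) k Y) (homology_sys_map TYPE('g) k X Y r) \<mu> l =
      zero_hom (ob (homology_sys TYPE('g) k X) l) (ob (homology_sys TYPE('g) k Y) \<mu>)"
    using l(1) rl sl \<mu> by (intro bexI[of _ l])
      (simp_all add: shift_homology_sys_map[OF X m(1)] shift_homology_sys_map[OF X m(2)])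
qed

theorem theorem9:
  fixes X :: "('i, 'a topology, ('a \<Rightarrow> 'a) set) inv_sys"
    and Y :: "('j, 'a topology, ('a \<Rightarrow> 'a) set) inv_sys"
    and f :: "('i, 'j, ('a \<Rightarrow> 'a) set) sys_map set"
    and n k :: nat
  assumes "inverse_system (HPol TYPE('v)) X"
    and "inverse_system (HPol TYPE('v)) Y"
    and "f \<in> pro_mors (HPol TYPE('v)) X Y"
    and "pro_dim_le TYPE('v) X Y f n"
    and "k > n"
  shows "zero_pro_morphism
           (homology_sys TYPE('g::ab_group_add) k X) (homology_sys TYPE('g) k Y)
           (homology_pro TYPE('g) k X Y f)"
proof -
  let ?H = "homology_sys_map TYPE('g) k X Y"
  obtain s where s: "s \<in> f" "sys_dim_le TYPE('v) X Y s n"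
    using assms(4) by (auto simp: pro_dim_le_def)
  note f = pro_morsE[OF is_category_HPol assms(1-3)]
  \<comment> \<open>\<open>homology_pro\<close> is a union over all representatives, so each of them
    is compared with the one of bounded dimension.\<close>
  have "?H r \<in> sys_mors Grp (homology_sys TYPE('g) k X) (homology_sys TYPE('g) k Y) \<and>
      eventually_zero (homology_sys TYPE('g) k X) (homology_sys TYPE('g) k Y) (?H r)" if "r \<in> f" for r
    using homology_sys_map_in_sys_mors[OF assms(1,2) f(1)[OF that]]
      eventually_zero_homology_sys_map[OF assms(1,2) f(2)[OF s(1) that] s(2) assms(5)] by blast
  then have "zero_pro_morphism (homology_sys TYPE('g) k X) (homology_sys TYPE('g) k Y)
      (\<Union>t\<in>?H ` f. sys_rel Grp (homology_sys TYPE('g) k X) (homology_sys TYPE('g) k Y) `` {t})"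
    using s(1) inverse_system_homology_sys[OF assms(1)] inverse_system_homology_sys[OF assms(2)]
    by (intro zero_pro_morphismI) auto
  then show ?thesis
    by (simp add: homology_pro_def)
qed

end
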